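(* Let $X,Y$ be measurable spaces such that either $X$ is countable and discrete or $Y$ is standard Borel, and let $k,l$ be s-finite kernels from $X$ to $Y$. Then $k$ decomposes uniquely as a sum of three (pairwise) mutually singular kernels from $X$ to $Y$, $$k=k_a+k_\infty+k_s,$$ where $k_a\stackrel{\infty}{\ll}l$, $k_\infty$ is $\infty$-singular with respect to $l$, and $k_s$ and $l$ are mutually singular. It then follows that $k_a$ and $k_s$ are s-finite and $k_\infty$ is $\sigma$-finite.
   Context: A kernel from a measurable space $X$ to a measurable space $Y$ is a map $k:X\times\Sigma_Y\to[0,\infty]$ that is measurable in its first argument and a measure in its second; $k(x)$ denotes the measure $k(x,-)$. It is finite if $\sup_{x\in X}k(x,Y)<\infty$; s-finite if $k=\sum_{i\in\mathbb{N}}k_i$ with each $k_i$ a finite kernel from $X$ to $Y$; $\sigma$-finite if moreover the $k_i$ can be chosen pairwise mutually singular. For $C\in\Sigma_{X\times Y}$ write $C^x=\{y\mid (x,y)\in C\}$; $k$ is supported in $C$ if $k(x,Y\setminus C^x)=0$ for all $x$. Kernels $k,l$ from $X$ to $Y$ are mutually singular if there is $A\in\Sigma_{X\times Y}$ such that $k$ is supported in $A$ and $l$ is supported in $(X\times Y)\setminus A$. Given a measure $m$ on $Y$, a set $U\in\Sigma_Y$ is an $m$-$0$-$\infty$-set if every measurable $V\subseteq U$ satisfies $m(V)\in\{0,\infty\}$; it is trivial if $m(U)=0$. For kernels $k,l$ from $X$ to $Y$: $k\ll l$ means that for all $x\in X$ every $l(x)$-null set is $k(x)$-null; $k\stackrel{\infty}{\ll}l$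 means that $k\ll l$ and, for all $x\in X$, every $l(x)$-$0$-$\infty$-set is a $k(x)$-$0$-$\infty$-set. The kernel $k$ is $\infty$-singular with respect to $l$ if $k\ll l$, for every $x\in X$ all $k(x)$-$0$-$\infty$-sets are trivial, and there exists $A\in\Sigma_{X\times Y}$ such that $k$ is supported in $A$ and $A^x$ is an $l(x)$-$0$-$\infty$-set for every $x\in X$. A countable discrete space carries the $\sigma$-algebra of all subsets; a standard Borel space is a set with the Borel $\sigma$-algebra of some complete separable metric. *)

theory Defs
  imports "HOL-Analysis.Analysis"
begin

text \<open>
  A measurable space is represented by a measure of which only \<open>space\<close> and \<open>sets\<close> are used.
  A kernel from \<open>X\<close> to \<open>Y\<close> is a measure-valued function; its values outside \<open>space X\<close> carry no
  meaning, so kernels are only ever compared on \<open>space X\<close>.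
\<close>

definition standard_borel :: "'a measure \<Rightarrow> bool" where
  "standard_borel Y \<longleftrightarrow>
    (\<exists>d. Metric_space (space Y) d
       \<and> Metric_space.mcomplete (space Y) d
       \<and> separable_space (Metric_space.mtopology (space Y) d)
       \<and> sets Y = sigma_sets (space Y) {U. openin (Metric_space.mtopology (space Y) d) U})"

definition countable_discrete :: "'a measure \<Rightarrow> bool" where
  "countable_discrete X \<longleftrightarrow> countable (space X) \<and> sets X = Pow (space X)"

definition kernel :: "'a measure \<Rightarrow> 'b measure \<Rightarrow> ('a \<Rightarrow> 'b measure) \<Rightarrow> bool" where
  "kernel X Y k \<longleftrightarrow>
    (\<forall>x\<in>space X. sets (k x) = sets Y) \<and>
    (\<forall>B\<in>sets Y. (\<lambda>x. emeasure (k x) B) \<in> borel_measurable X)"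

definition finite_kernel :: "'a measure \<Rightarrow> 'b measure \<Rightarrow> ('a \<Rightarrow> 'b measure) \<Rightarrow> bool" where
  "finite_kernel X Y k \<longleftrightarrow> kernel X Y k \<and> (SUP x\<in>space X. emeasure (k x) (space Y)) < \<infinity>"

definition kernel_suminf ::
    "'a measure \<Rightarrow> 'b measure \<Rightarrow> (nat \<Rightarrow> 'a \<Rightarrow> 'b measure) \<Rightarrow> ('a \<Rightarrow> 'b measure) \<Rightarrow> bool" where
  "kernel_suminf X Y ki k \<longleftrightarrow>
    (\<forall>x\<in>space X. \<forall>B\<in>sets Y. emeasure (k x) B = (\<Sum>i. emeasure (ki i x) B))"

definition s_finite_kernel :: "'a measure \<Rightarrow> 'b measure \<Rightarrow> ('a \<Rightarrow> 'b measure) \<Rightarrow> bool" where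
  "s_finite_kernel X Y k \<longleftrightarrow>
    kernel X Y k \<and> (\<exists>ki. (\<forall>i. finite_kernel X Y (ki i)) \<and> kernel_suminf X Y ki k)"

text \<open>Measurability of \<open>C\<close> is part of the definition because \<open>emeasure\<close> is 0 on non-measurable sets.\<close>

definition supported_in ::
    "'a measure \<Rightarrow> 'b measure \<Rightarrow> ('a \<Rightarrow> 'b measure) \<Rightarrow> ('a \<times> 'b) set \<Rightarrow> bool" where
  "supported_in X Y k C \<longleftrightarrow>
    C \<in> sets (X \<Otimes>\<^sub>M Y) \<and> (\<forall>x\<in>space X. emeasure (k x) (space Y - Pair x -` C) = 0)"

definition mutually_singular ::
    "'a measure \<Rightarrow> 'b measure \<Rightarrow> ('a \<Rightarrow> 'b measure) \<Rightarrow> ('a \<Rightarrow> 'b measure) \<Rightarrow> bool" where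
  "mutually_singular X Y k l \<longleftrightarrow>
    (\<exists>A\<in>sets (X \<Otimes>\<^sub>M Y). supported_in X Y k A \<and> supported_in X Y l (space (X \<Otimes>\<^sub>M Y) - A))"

definition sigma_finite_kernel :: "'a measure \<Rightarrow> 'b measure \<Rightarrow> ('a \<Rightarrow> 'b measure) \<Rightarrow> bool" where
  "sigma_finite_kernel X Y k \<longleftrightarrow>
    kernel X Y k \<and>
    (\<exists>ki. (\<forall>i. finite_kernel X Y (ki i)) \<and> kernel_suminf X Y ki k \<and>
          (\<forall>i j. i \<noteq> j \<longrightarrow> mutually_singular X Y (ki i) (ki j)))"

definition zero_infty_set :: "'b measure \<Rightarrow> 'b set \<Rightarrow> bool" where
  "zero_infty_set m U \<longleftrightarrow>
    U \<in> sets m \<and> (\<forall>V\<in>sets m. V \<subseteq> U \<longrightarrow> emeasure m V \<in> {0, \<infinity>})"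

text \<open>\<open>kernel_ac X k l\<close> reads absolute continuity of \<open>k\<close> with respect to \<open>l\<close>; note that the library's \<open>absolutely_continuous\<close>
  takes the dominating measure first.\<close>

definition kernel_ac ::
    "'a measure \<Rightarrow> ('a \<Rightarrow> 'b measure) \<Rightarrow> ('a \<Rightarrow> 'b measure) \<Rightarrow> bool" where
  "kernel_ac X k l \<longleftrightarrow> (\<forall>x\<in>space X. absolutely_continuous (l x) (k x))"

definition kernel_infty_ac ::
    "'a measure \<Rightarrow> ('a \<Rightarrow> 'b measure) \<Rightarrow> ('a \<Rightarrow> 'b measure) \<Rightarrow> bool" where
  "kernel_infty_ac X k l \<longleftrightarrow>
    kernel_ac X k l \<and> (\<forall>x\<in>space X. \<forall>U. zero_infty_set (l x) U \<longrightarrow> zero_infty_set (k x) U)"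

definition infty_singular ::
    "'a measure \<Rightarrow> 'b measure \<Rightarrow> ('a \<Rightarrow> 'b measure) \<Rightarrow> ('a \<Rightarrow> 'b measure) \<Rightarrow> bool" where
  "infty_singular X Y k l \<longleftrightarrow>
    kernel_ac X k l \<and>
    (\<forall>x\<in>space X. \<forall>U. zero_infty_set (k x) U \<longrightarrow> emeasure (k x) U = 0) \<and>
    (\<exists>A\<in>sets (X \<Otimes>\<^sub>M Y). supported_in X Y k A \<and>
        (\<forall>x\<in>space X. zero_infty_set (l x) (Pair x -` A)))"

text \<open>The three summands are arbitrary kernels; no finiteness is imposed on them.\<close>

definition lebesgue_decomposition ::
    "'a measure \<Rightarrow> 'b measure \<Rightarrow> ('a \<Rightarrow> 'b measure) \<Rightarrow> ('a \<Rightarrow> 'b measure) \<Rightarrow>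
     ('a \<Rightarrow> 'b measure) \<Rightarrow> ('a \<Rightarrow> 'b measure) \<Rightarrow> ('a \<Rightarrow> 'b measure) \<Rightarrow> bool" where
  "lebesgue_decomposition X Y k l ka kinf ks \<longleftrightarrow>
    kernel X Y ka \<and> kernel X Y kinf \<and> kernel X Y ks \<and>
    (\<forall>x\<in>space X. \<forall>B\<in>sets Y.
        emeasure (k x) B = emeasure (ka x) B + emeasure (kinf x) B + emeasure (ks x) B) \<and>
    mutually_singular X Y ka kinf \<and> mutually_singular X Y ka ks \<and> mutually_singular X Y kinf ks \<and>
    kernel_infty_ac X ka l \<and>
    infty_singular X Y kinf l \<and>
    mutually_singular X Y ks l"

end

theory Submission
  imports Defs
begin

text \<open>
  Some finite kernel \<open>\<nu>\<close> dominates all the finite summands of \<open>k\<close> and \<open>l\<close>, and each summand has a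
  jointly measurable density with respect to \<open>\<nu>\<close>; summing gives \<open>k = f \<cdot> \<nu>\<close> and \<open>l = g \<cdot> \<nu>\<close> with
  \<open>f, g\<close> valued in \<open>[0,\<infinity>]\<close>. Restricting \<open>k\<close> to \<open>{g = 0}\<close>, \<open>{g = \<infinity>, f < \<infinity>}\<close> and the remaining set
  yields \<open>k\<^sub>s\<close>, \<open>k\<^sub>\<infinity>\<close> and \<open>k\<^sub>a\<close>, because \<open>U\<close> is a 0-\<open>\<infinity>\<close>-set of \<open>g \<cdot> \<nu>\<close> exactly if \<open>g \<in> {0,\<infinity>}\<close> almost
  everywhere on \<open>U\<close>. Uniqueness holds pointwise in \<open>x\<close>, for arbitrary measures: \<open>k\<^sub>s\<close> is \<open>k\<close> restricted to an
  \<open>l\<close>-null set, and \<open>k\<^sub>\<infinity>\<close> lives on an \<open>l\<close>-0-\<open>\<infinity>\<close>-set, on which the part \<open>k\<^sub>a'\<close> of any other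
  decomposition takes only the values 0 and \<open>\<infinity>\<close>, so that \<open>k\<^sub>\<infinity>\<close> cannot overlap with it.

  For standard Borel \<open>Y\<close>, joint measurability of a density \<open>p\<^sub>x\<close> is obtained through the sets
  \<open>H\<^sub>x = {p\<^sub>x > r}\<close>: they maximise \<open>\<mu>(x,A) - r \<nu>(x,A)\<close> over \<open>A\<close>, near-maximisers can be selected measurably
  in \<open>x\<close> from a countable generating algebra, and by Borel--Cantelli the upper limit of \<open>2\<^sup>-\<^sup>n\<close>-near-maximisers
  agrees with \<open>H\<^sub>x\<close> almost everywhere off \<open>{p\<^sub>x = r}\<close>.
\<close>

section \<open>Approximation by a countable generating algebra\<close>

text \<open>Complements and binary unions are adjoined in countably many rounds. Each round keeps
  the family countable and inside the generated sigma-algebra. The rounds increase, so any two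
  members already occur in a common round and their union in the next one.\<close>

lemma countable_algebra_generated:
  assumes "countable \<G>" and "\<G> \<subseteq> Pow \<Omega>"
  obtains \<A> where "countable \<A>" "algebra \<Omega> \<A>" "sigma_sets \<Omega> \<A> = sigma_sets \<Omega> \<G>"
proof -
  define F where "F \<S> = \<S> \<union> (\<lambda>S. \<Omega> - S) ` \<S> \<union> (\<lambda>(S, T). S \<union> T) ` (\<S> \<times> \<S>)" for \<S> :: "'a set set"
  define A where "A n = (F ^^ n) (insert {} \<G>)" for n
  have A_Suc: "A (Suc n) = F (A n)" and A_0: "A 0 = insert {} \<G>" for n
    by (auto simp: A_def)
  have count: "countable (A n)" for n
    by (induction n) (auto simp: A_0 A_Suc F_def assms)
  have sub: "A n \<subseteq> sigma_sets \<Omega> \<G>" for n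
  proof (induction n)
    case 0
    then show ?case
      by (auto simp: A_0 intro: sigma_sets.intros)
  next
    case (Suc n)
    then show ?case
      by (auto simp: A_Suc F_def intro!: sigma_sets_Un intro: sigma_sets.intros)
  qed
  have mono: "A m \<subseteq> A n" if "m \<le> n" for m n
    using that by (rule lift_Suc_mono_le[rotated]) (auto simp: A_Suc F_def)
  have union: "S \<union> T \<in> (\<Union>n. A n)" if "S \<in> A m" "T \<in> A n" for S T m n
  proof -
    have "S \<in> A (max m n)" "T \<in> A (max m n)"
      using that mono[of m "max m n"] mono[of n "max m n"] by auto
    then have "S \<union> T \<in> A (Suc (max m n))"
      by (auto simp: A_Suc F_def)
    then show ?thesis by blast
  qed
  have diff: "\<Omega> - S \<in> (\<Union>n. A n)" if "S \<in> A m" for S m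
  proof -
    have "\<Omega> - S \<in> A (Suc m)"
      using that by (auto simp: A_Suc F_def)
    then show ?thesis by blast
  qed
  have "{} \<in> A 0"
    by (simp add: A_0)
  then have empty: "{} \<in> (\<Union>n. A n)"
    by blast
  show thesis
  proof
    show "countable (\<Union>n. A n)"
      using count by simp
    show "algebra \<Omega> (\<Union>n. A n)"
      unfolding algebra_iff_Un
    proof (intro conjI ballI)
      show "(\<Union>n. A n) \<subseteq> Pow \<Omega>"
        using sub sigma_sets_into_sp[OF assms(2)] by blast
      show "{} \<in> (\<Union>n. A n)"
        by (fact empty)
      show "\<Omega> - S \<in> (\<Union>n. A n)" if "S \<in> (\<Union>n. A n)" for S
        using that diff by (elim UN_E)
      show "S \<union> T \<in> (\<Union>n. A n)" if "S \<in> (\<Union>n. A n)" "T \<in> (\<Union>n. A n)" for S T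
        using that union by (elim UN_E)
    qed
    show "sigma_sets \<Omega> (\<Union>n. A n) = sigma_sets \<Omega> \<G>"
    proof (rule sigma_sets_eqI)
      show "a \<in> sigma_sets \<Omega> \<G>" if "a \<in> (\<Union>n. A n)" for a
        using that sub by blast
      show "b \<in> sigma_sets \<Omega> (\<Union>n. A n)" if "b \<in> \<G>" for b
        using that A_0 by (intro sigma_sets.Basic) blast
    qed
  qed
qed

text \<open>Balls of radius \<open>1/(n+1)\<close> around the points of a countable dense set form a
  countable base: every open set is the union of the countably many such balls that it contains.
  Hence they generate the Borel sets, and so does the algebra they span.\<close>

lemma standard_borel_countable_algebra:
  assumes "standard_borel Y"
  obtains \<A> where "countable \<A>" "algebra (space Y) \<A>" "sets Y = sigma_sets (space Y) \<A>"
proof -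
  obtain d where d: "Metric_space (space Y) d"
    and sep: "separable_space (Metric_space.mtopology (space Y) d)"
    and Y: "sets Y = sigma_sets (space Y) {U. openin (Metric_space.mtopology (space Y) d) U}"
    using assms unfolding standard_borel_def by blast
  interpret Metric_space "space Y" d by fact
  obtain C where C: "countable C" "C \<subseteq> space Y" "mtopology closure_of C = space Y"
    using sep unfolding separable_space_def by auto
  define \<G> where "\<G> = (\<lambda>(c, n). mball c (inverse (Suc n))) ` (C \<times> (UNIV :: nat set))"
  have "countable \<G>"
    using C by (auto simp: \<G>_def)
  moreover have "\<G> \<subseteq> Pow (space Y)"
    by (auto simp: \<G>_def)
  moreover have "sigma_sets (space Y) \<G> = sets Y"
    unfolding Y
  proof (rule sigma_sets_eqI)
    show "a \<in> sigma_sets (space Y) {U. openin mtopology U}" if "a \<in> \<G>" for a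
      using that by (auto simp: \<G>_def intro!: sigma_sets.Basic)
    show "U \<in> sigma_sets (space Y) \<G>" if "U \<in> {U. openin mtopology U}" for U
    proof -
      have U: "openin mtopology U"
        using that by simp
      have "U = \<Union>{B \<in> \<G>. B \<subseteq> U}"
      proof safe
        fix y assume y: "y \<in> U"
        then obtain r where r: "r > 0" "mball y r \<subseteq> U" and yY: "y \<in> space Y"
          using U y unfolding openin_mtopology by blast
        \<comment> \<open>Half of \<open>r\<close> suffices by the triangle inequality: a ball of
          this radius that contains \<open>y\<close> stays within distance \<open>r\<close> of
          \<open>y\<close>.\<close>
        obtain n where n: "inverse (real (Suc n)) < r / 2"
          using reals_Archimedean[of "r / 2"] r by auto
        have "\<exists>c\<in>C. c \<in> mball y (inverse (Suc n))"
        proof -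
          have "y \<in> mtopology closure_of C"
            using C(3) yY by simp
          moreover have "inverse (real (Suc n)) > 0"
            by simp
          ultimately show ?thesis
            unfolding metric_closure_of by blast
        qed
        then obtain c where c: "c \<in> C" "d y c < inverse (Suc n)"
          by auto
        have cY: "c \<in> space Y"
          using c C by auto
        have "mball c (inverse (Suc n)) \<subseteq> mball y r"
        proof
          fix z assume "z \<in> mball c (inverse (Suc n))"
          then show "z \<in> mball y r"
            using triangle[of y c z] cY yY c n by auto
        qed
        then have "mball c (inverse (Suc n)) \<in> {B \<in> \<G>. B \<subseteq> U}"
          using r c by (auto simp: \<G>_def)
        moreover have "y \<in> mball c (inverse (Suc n))"
          using c cY yY by (auto simp: commute)
        ultimately show "y \<in> \<Union>{B \<in> \<G>. B \<subseteq> U}"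
          by blast
      qed auto
      moreover have "countable {B \<in> \<G>. B \<subseteq> U}"
        using \<open>countable \<G>\<close> by (rule countable_subset[rotated]) auto
      then have "\<Union>{B \<in> \<G>. B \<subseteq> U} \<in> sigma_sets (space Y) \<G>"
        by (rule sigma_sets_UNION) (auto intro: sigma_sets.Basic)
      ultimately show ?thesis
        by simp
    qed
  qed
  ultimately show thesis
    using countable_algebra_generated[of \<G> "space Y"] that by metis
qed

text \<open>Induction over the generation of the sigma-algebra. Complementation leaves symmetric
  differences unchanged. A countable union is first cut to finitely many sets, by continuity from
  below, and these are then approximated one by one; each of the two stages costs at most
  \<open>e / 2\<close>.\<close>

lemma (in finite_measure) approx_by_generating_algebra:
  assumes "algebra (space M) \<A>" and M: "sets M = sigma_sets (space M) \<A>"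
    and "B \<in> sets M" and "0 < e"
  shows "\<exists>A\<in>\<A>. measure M ((A - B) \<union> (B - A)) < e"
proof -
  interpret A: algebra "space M" \<A> by fact
  have A_sets: "A \<in> sets M" if "A \<in> \<A>" for A
    using that by (auto simp: M)
  have "B \<in> sigma_sets (space M) \<A>"
    using assms by simp
  then show ?thesis
    using \<open>0 < e\<close>
  proof (induction arbitrary: e)
    case (Basic a)
    then show ?case
      by (intro bexI[of _ a]) auto
  next
    case Empty
    then show ?case
      by (intro bexI[of _ "{}"]) auto
  next
    case (Compl a)
    then obtain A where A: "A \<in> \<A>" "measure M ((A - a) \<union> (a - A)) < e"
      by blast
    moreover have "A \<subseteq> space M" "a \<subseteq> space M"
      using A A_sets sets.sets_into_space Compl(1) by (auto simp flip: M dest: sets.sets_into_space)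
    then have "(space M - A - (space M - a)) \<union> (space M - a - (space M - A)) = (A - a) \<union> (a - A)"
      by auto
    ultimately show ?case
      by (intro bexI[of _ "space M - A"]) auto
  next
    case (Union a)
    have a: "a i \<in> sets M" for i
      using Union(1) by (simp add: M)
    have "(\<lambda>n. measure M (\<Union>i<n. a i)) \<longlonglongrightarrow> measure M (\<Union>n. \<Union>i<n. a i)"
      using a by (intro finite_Lim_measure_incseq) (auto simp: incseq_def intro: less_le_trans)
    also have "(\<Union>n. \<Union>i<n. a i) = (\<Union>i. a i)"
      by auto
    finally have "eventually (\<lambda>n. dist (measure M (\<Union>i<n. a i)) (measure M (\<Union>i. a i)) < e / 2) sequentially"
      using Union(3) by (intro tendstoD) auto
    then obtain n where n: "dist (measure M (\<Union>i<n. a i)) (measure M (\<Union>i. a i)) < e / 2"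
      by (auto simp: eventually_sequentially)
    have tail: "measure M ((\<Union>i. a i) - (\<Union>i<n. a i)) < e / 2"
    proof (subst finite_measure_Diff)
      show "measure M (\<Union>i. a i) - measure M (\<Union>i<n. a i) < e / 2"
        using n unfolding dist_real_def by linarith
    qed (use a in auto)
    \<comment> \<open>The cut-off \<open>n\<close> is already fixed here, so each of the
      \<open>n\<close> approximations may err by \<open>e / (2 * Suc n)\<close>; together they err
      by at most \<open>e / 2\<close>.\<close>
    have "\<exists>A\<in>\<A>. measure M ((A - a i) \<union> (a i - A)) < e / (2 * Suc n)" for i
      using Union(3) by (intro Union(2)) auto
    then obtain A where A: "\<And>i. A i \<in> \<A>" "\<And>i. measure M ((A i - a i) \<union> (a i - A i)) < e / (2 * Suc n)"
      by metis
    let ?D = "\<lambda>i. (A i - a i) \<union> (a i - A i)"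
    have D: "?D i \<in> sets M" for i
      using a A(1) A_sets by auto
    have "measure M (((\<Union>i<n. A i) - (\<Union>i. a i)) \<union> ((\<Union>i. a i) - (\<Union>i<n. A i)))
        \<le> measure M (((\<Union>i. a i) - (\<Union>i<n. a i)) \<union> (\<Union>i<n. ?D i))"
      using a D by (intro finite_measure_mono) auto
    also have "\<dots> \<le> measure M ((\<Union>i. a i) - (\<Union>i<n. a i)) + measure M (\<Union>i<n. ?D i)"
      using a D by (intro measure_Un_le) auto
    also have "measure M (\<Union>i<n. ?D i) \<le> (\<Sum>i<n. measure M (?D i))"
      using D by (intro finite_measure_subadditive_finite) auto
    also have "\<dots> \<le> (\<Sum>i<n. e / (2 * Suc n))"
      using A(2) by (intro sum_mono) (auto intro: less_imp_le)
    also have "\<dots> = real n * (e / (2 * Suc n))"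
      by simp
    also have "\<dots> \<le> e / 2"
      using Union(3) by (simp add: field_simps)
    finally have "measure M (((\<Union>i<n. A i) - (\<Union>i. a i)) \<union> ((\<Union>i. a i) - (\<Union>i<n. A i))) < e"
      using tail by simp
    moreover have "(\<Union>i<n. A i) \<in> \<A>"
      using A by (intro A.finite_UN) auto
    ultimately show ?case
      by blast
  qed
qed

section \<open>Jointly measurable densities\<close>

text \<open>The function \<open>p - r\<close> is positive exactly on \<open>H\<close>, so
  \<open>H\<close> maximises its integral, and the amount by which \<open>A\<close> falls short is
  the integral of \<open>\<bar>p - r\<bar>\<close> over the symmetric difference. Being nearly
  optimal thus means being close to \<open>H\<close> in the finite measure
  \<open>\<tau>\<close>.\<close>

lemma (in finite_measure) integral_diff_threshold:
  fixes p :: "'a \<Rightarrow> real" and r :: real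
  assumes p: "integrable M p" and A: "A \<in> sets M"
  defines "H \<equiv> {y \<in> space M. r < p y}"
  defines "\<tau> \<equiv> density M (\<lambda>y. ennreal \<bar>p y - r\<bar>)"
  shows "finite_measure \<tau>"
    and "measure \<tau> ((A - H) \<union> (H - A)) = (\<integral>y\<in>H. (p y - r) \<partial>M) - (\<integral>y\<in>A. (p y - r) \<partial>M)"
proof -
  have [measurable]: "p \<in> borel_measurable M" "A \<in> sets M"
    using p A by auto
  have H [measurable]: "H \<in> sets M"
    unfolding H_def by measurable
  have int: "integrable M (\<lambda>y. p y - r)"
    using p by simp
  have int_on: "set_integrable M B (\<lambda>y. p y - r)" if "B \<in> sets M" for B
    using int that unfolding set_integrable_def by (intro integrable_mult_indicator)
  have em: "emeasure \<tau> B = ennreal (\<integral>y\<in>B. \<bar>p y - r\<bar> \<partial>M)" if [measurable]: "B \<in> sets M" for B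
  proof -
    have "emeasure \<tau> B = (\<integral>\<^sup>+y. ennreal (indicator B y *\<^sub>R \<bar>p y - r\<bar>) \<partial>M)"
      unfolding \<tau>_def by (subst emeasure_density) (auto intro!: nn_integral_cong split: split_indicator)
    also have "\<dots> = ennreal (\<integral>y\<in>B. \<bar>p y - r\<bar> \<partial>M)"
      unfolding set_lebesgue_integral_def
      using int by (intro nn_integral_eq_integral integrable_mult_indicator) auto
    finally show ?thesis .
  qed
  show "finite_measure \<tau>"
    using em[of "space M"] by (intro finite_measureI) (simp add: \<tau>_def)
  have "measure \<tau> ((A - H) \<union> (H - A)) = (\<integral>y\<in>(A - H) \<union> (H - A). \<bar>p y - r\<bar> \<partial>M)"
    unfolding measure_def by (subst em) (auto simp: set_lebesgue_integral_def)
  also have "\<dots> = (\<integral>y. indicator H y *\<^sub>R (p y - r) - indicator A y *\<^sub>R (p y - r) \<partial>M)"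
    unfolding set_lebesgue_integral_def
    using sets.sets_into_space[OF A]
    by (intro Bochner_Integration.integral_cong refl) (auto simp: H_def split: split_indicator)
  also have "\<dots> = (\<integral>y\<in>H. (p y - r) \<partial>M) - (\<integral>y\<in>A. (p y - r) \<partial>M)"
    unfolding set_lebesgue_integral_def
    using int_on[OF H] int_on[OF A] unfolding set_integrable_def
    by (rule Bochner_Integration.integral_diff)
  finally show "measure \<tau> ((A - H) \<union> (H - A)) = (\<integral>y\<in>H. (p y - r) \<partial>M) - (\<integral>y\<in>A. (p y - r) \<partial>M)" .
qed

section \<open>Elementary facts about kernels, and measurable selection of threshold sets\<close>

lemma kernel_measurable: "kernel X Y k \<Longrightarrow> B \<in> sets Y \<Longrightarrow> (\<lambda>x. emeasure (k x) B) \<in> borel_measurable X"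
  by (simp add: kernel_def)

lemma kernel_sets: "kernel X Y k \<Longrightarrow> x \<in> space X \<Longrightarrow> sets (k x) = sets Y"
  by (simp add: kernel_def)

lemma kernel_space: "kernel X Y k \<Longrightarrow> x \<in> space X \<Longrightarrow> space (k x) = space Y"
  by (rule sets_eq_imp_space_eq[OF kernel_sets])

lemma finite_kernel_kernel: "finite_kernel X Y k \<Longrightarrow> kernel X Y k"
  by (simp add: finite_kernel_def)

lemma finite_kernelD:
  assumes "finite_kernel X Y k" "x \<in> space X"
  shows "finite_measure (k x)" "sets (k x) = sets Y" "space (k x) = space Y"
proof -
  show s: "sets (k x) = sets Y" "space (k x) = space Y"
    using finite_kernel_kernel[OF assms(1)] assms(2) by (simp_all add: kernel_sets kernel_space)
  have "emeasure (k x) (space Y) \<le> (SUP x\<in>space X. emeasure (k x) (space Y))"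
    using assms(2) by (rule SUP_upper)
  then show "finite_measure (k x)"
    using assms(1) s by (intro finite_measureI) (auto simp: finite_kernel_def)
qed

text \<open>Each \<open>p x\<close> is measurable, with no regularity in \<open>x\<close>; joint
  measurability has to come from the values of \<open>\<mu> x\<close> and \<open>\<nu> x\<close> on
  the algebra. These determine which algebra sets nearly maximise
  \<open>\<mu> x - r \<nu> x\<close>, and such sets are close to \<open>{p x > r}\<close> in
  \<open>\<tau> x\<close>. Since \<open>\<tau> x\<close> does not see the level set
  \<open>{p x = r}\<close>, nothing is claimed there.\<close>

lemma measurable_threshold_set:
  fixes \<mu> \<nu> :: "'a \<Rightarrow> 'b measure"
  assumes \<A>: "countable \<A>" "algebra (space Y) \<A>" "sets Y = sigma_sets (space Y) \<A>"
    and \<mu>: "finite_kernel X Y \<mu>" and \<nu>: "finite_kernel X Y \<nu>"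
    and p: "\<And>x. x \<in> space X \<Longrightarrow> p x \<in> borel_measurable Y" "\<And>x y. 0 \<le> p x y"
    and dens: "\<And>x. x \<in> space X \<Longrightarrow> \<mu> x = density (\<nu> x) (\<lambda>y. ennreal (p x y))"
  shows "\<exists>L\<in>sets (X \<Otimes>\<^sub>M Y). \<forall>x\<in>space X. AE y in \<nu> x. p x y \<noteq> r \<longrightarrow> ((x, y) \<in> L \<longleftrightarrow> r < p x y)"
proof -
  interpret \<A>: algebra "space Y" \<A> by fact
  define A where "A = from_nat_into \<A>"
  have range_A: "range A = \<A>"
    unfolding A_def using \<A>(1) \<A>.top by (intro range_from_nat_into) auto
  then have A [measurable]: "A i \<in> sets Y" for i
    using \<A>(3) by (auto intro!: sigma_sets.Basic)
  \<comment> \<open>\<open>\<sigma> i\<close> and its supremum \<open>s\<close> are computed from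
    the kernels and hence measurable in \<open>x\<close>; \<open>H\<close>, \<open>\<tau>\<close>
    and \<open>D\<close> depend on \<open>p\<close> and serve only for estimates at a fixed
    \<open>x\<close>.\<close>
  define \<sigma> where "\<sigma> i x = measure (\<mu> x) (A i) - r * measure (\<nu> x) (A i)" for i x
  define s where "s x = (SUP i. \<sigma> i x)" for x
  define H where "H x = {y \<in> space (\<nu> x). r < p x y}" for x
  define \<tau> where "\<tau> x = density (\<nu> x) (\<lambda>y. ennreal \<bar>p x y - r\<bar>)" for x
  define D where "D i x = (A i - H x) \<union> (H x - A i)" for i x
  have sets_\<nu>: "sets (\<nu> x) = sets Y" "space (\<nu> x) = space Y" if "x \<in> space X" for x
    using finite_kernelD[OF \<nu> that] by auto
  have p_meas: "p x \<in> borel_measurable (\<nu> x)" if "x \<in> space X" for x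
    using p(1)[OF that] sets_\<nu>[OF that] by (simp cong: measurable_cong_sets)
  have \<tau>_fin: "finite_measure (\<tau> x)"
    and \<tau>_D: "measure (\<tau> x) (D i x) = (\<integral>y\<in>H x. (p x y - r) \<partial>\<nu> x) - \<sigma> i x"
    if x: "x \<in> space X" for x i
  proof -
    interpret \<nu>: finite_measure "\<nu> x"
      using finite_kernelD[OF \<nu> x] by simp
    interpret \<mu>: finite_measure "\<mu> x"
      using finite_kernelD[OF \<mu> x] by simp
    note [measurable] = p_meas[OF x]
    have Ax [measurable]: "A i \<in> sets (\<nu> x)" for i
      using A sets_\<nu>[OF x] by simp
    have "(\<integral>\<^sup>+y. ennreal (p x y) \<partial>\<nu> x) = emeasure (\<mu> x) (space (\<nu> x))"
      using dens[OF x] by (simp add: emeasure_density cong: nn_integral_cong)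
    then have int: "integrable (\<nu> x) (p x)"
      using \<mu>.emeasure_finite p(2) by (intro integrableI_nonneg) (auto simp: less_top[symmetric])
    have "measure (\<mu> x) (A i) = (\<integral>y. indicator (A i) y \<partial>\<mu> x)"
      using Ax finite_kernelD(2)[OF \<mu> x] by simp
    also have "\<dots> = (\<integral>y\<in>A i. p x y \<partial>\<nu> x)"
      unfolding dens[OF x] set_lebesgue_integral_def
      using p(2) by (subst integral_density) (auto simp: mult.commute)
    finally have "measure (\<mu> x) (A i) = (\<integral>y\<in>A i. p x y \<partial>\<nu> x)" .
    moreover have "(\<integral>y\<in>A i. (p x y - r) \<partial>\<nu> x) = (\<integral>y\<in>A i. p x y \<partial>\<nu> x) - (\<integral>y\<in>A i. r \<partial>\<nu> x)"
      using integrable_mult_indicator[OF Ax int, of i]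
      by (intro set_integral_diff) (auto simp: set_integrable_def intro!: \<nu>.integrable_const_bound[where B = 1] split: split_indicator)
    ultimately have \<sigma>: "\<sigma> i x = (\<integral>y\<in>A i. (p x y - r) \<partial>\<nu> x)"
      by (simp add: \<sigma>_def set_lebesgue_integral_def)
    show "finite_measure (\<tau> x)"
      unfolding \<tau>_def by (rule \<nu>.integral_diff_threshold(1)[OF int Ax])
    show "measure (\<tau> x) (D i x) = (\<integral>y\<in>H x. (p x y - r) \<partial>\<nu> x) - \<sigma> i x"
      unfolding \<tau>_def D_def \<sigma> H_def by (rule \<nu>.integral_diff_threshold(2)[OF int Ax])
  qed
  have H_sets: "H x \<in> sets (\<nu> x)" if "x \<in> space X" for x
    using p_meas[OF that] unfolding H_def by measurable
  have D_sets: "D i x \<in> sets (\<tau> x)" if "x \<in> space X" for x i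
    using A H_sets[OF that] sets_\<nu>[OF that] unfolding D_def \<tau>_def by auto
  have s_eq: "s x = (\<integral>y\<in>H x. (p x y - r) \<partial>\<nu> x)" and bdd: "bdd_above (range (\<lambda>i. \<sigma> i x))"
    if x: "x \<in> space X" for x
  proof -
    interpret \<tau>: finite_measure "\<tau> x"
      using \<tau>_fin[OF x] .
    have le: "\<sigma> i x \<le> (\<integral>y\<in>H x. (p x y - r) \<partial>\<nu> x)" for i
      using \<tau>_D[OF x, of i] measure_nonneg[of "\<tau> x" "D i x"] by linarith
    then show "bdd_above (range (\<lambda>i. \<sigma> i x))"
      by (rule bdd_aboveI2)
    show "s x = (\<integral>y\<in>H x. (p x y - r) \<partial>\<nu> x)"
      unfolding s_def
    proof (intro cSup_eq_non_empty)
      fix z assume z: "\<And>v. v \<in> range (\<lambda>i. \<sigma> i x) \<Longrightarrow> v \<le> z"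
      show "(\<integral>y\<in>H x. (p x y - r) \<partial>\<nu> x) \<le> z"
      proof (rule field_le_epsilon)
        fix e :: real assume "0 < e"
        \<comment> \<open>A member of the algebra within \<open>e\<close> of \<open>H x\<close> in
          \<open>\<tau> x\<close> has its \<open>\<sigma>\<close>-value within \<open>e\<close> of
          the integral over \<open>H x\<close>. So the supremum over the countable algebra is the
          optimum over all measurable sets.\<close>
        have "\<exists>B\<in>\<A>. measure (\<tau> x) ((B - H x) \<union> (H x - B)) < e"
          using \<A> sets_\<nu>[OF x] H_sets[OF x] \<open>0 < e\<close>
          by (intro \<tau>.approx_by_generating_algebra) (auto simp: \<tau>_def)
        then obtain i where "measure (\<tau> x) (D i x) < e"
          unfolding D_def range_A[symmetric] by auto
        then show "(\<integral>y\<in>H x. (p x y - r) \<partial>\<nu> x) \<le> z + e"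
          using \<tau>_D[OF x, of i] z[of "\<sigma> i x"] by simp
      qed
    qed (use le in auto)
  qed
  have \<sigma>_meas [measurable]: "\<sigma> i \<in> borel_measurable X" for i
    using kernel_measurable[OF finite_kernel_kernel[OF \<mu>] A] kernel_measurable[OF finite_kernel_kernel[OF \<nu>] A]
    unfolding \<sigma>_def measure_def by measurable
  have s_meas [measurable]: "s \<in> borel_measurable X"
    unfolding s_def using bdd by (intro borel_measurable_cSUP) auto
  \<comment> \<open>Taking the least index of a near-maximiser makes the choice measurable in
    \<open>x\<close>. The tolerances \<open>(1/2)^n\<close> are summable, as Borel-Cantelli will
    require.\<close>
  define I where "I n x = (LEAST i. s x - (1/2)^n < \<sigma> i x)" for n x
  have I: "s x - (1/2)^n < \<sigma> (I n x) x" if "x \<in> space X" for n x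
  proof -
    have "\<exists>i. s x - (1/2)^n < \<sigma> i x"
      using less_cSUP_iff[OF _ bdd[OF that], of "s x - (1/2)^n"] by (simp add: s_def)
    then show ?thesis
      unfolding I_def by (rule LeastI_ex)
  qed
  have [measurable]: "I n \<in> measurable X (count_space UNIV)" for n
    unfolding I_def by measurable
  \<comment> \<open>The section of \<open>L\<close> at \<open>x\<close> is the upper limit of the
    sets \<open>A (I n x)\<close>. The quantifier over \<open>i\<close> splits the condition into
    countably many pieces with constant index, each of them measurable.\<close>
  define L where "L = {z \<in> space (X \<Otimes>\<^sub>M Y). \<forall>m. \<exists>n\<ge>m. \<exists>i. I n (fst z) = i \<and> snd z \<in> A i}"
  have "L \<in> sets (X \<Otimes>\<^sub>M Y)"
    unfolding L_def by measurable
  moreover have "AE y in \<nu> x. p x y \<noteq> r \<longrightarrow> ((x, y) \<in> L \<longleftrightarrow> r < p x y)" if x: "x \<in> space X" for x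
  proof -
    interpret \<tau>: finite_measure "\<tau> x"
      using \<tau>_fin[OF x] .
    have small: "measure (\<tau> x) (D (I n x) x) \<le> (1/2)^n" for n
      using I[OF x, of n] \<tau>_D[OF x, of "I n x"] s_eq[OF x] by simp
    have "summable (\<lambda>n. measure (\<tau> x) (D (I n x) x))"
      by (rule summable_comparison_test'[where g = "\<lambda>n. (1/2)^n" and N = 0]) (auto simp: small)
    then have "AE y in \<tau> x. eventually (\<lambda>n. y \<in> space (\<tau> x) - D (I n x) x) sequentially"
      using D_sets[OF x] by (intro borel_cantelli_AE1) (auto simp: less_top[symmetric])
    then have "AE y in \<nu> x. 0 < ennreal \<bar>p x y - r\<bar> \<longrightarrow> eventually (\<lambda>n. y \<in> space (\<tau> x) - D (I n x) x) sequentially"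
      using p_meas[OF x] unfolding \<tau>_def by (subst (asm) AE_density) auto
    moreover have "AE y in \<nu> x. y \<in> space (\<nu> x)"
      by (rule AE_space)
    ultimately show ?thesis
    proof eventually_elim
      case (elim y)
      show ?case
      proof
        assume "p x y \<noteq> r"
        then obtain N where N: "\<And>n. n \<ge> N \<Longrightarrow> y \<notin> D (I n x) x"
          using elim by (auto simp: eventually_sequentially)
        then have N: "n \<ge> N \<Longrightarrow> y \<in> A (I n x) \<longleftrightarrow> r < p x y" for n
          using elim(2) by (auto simp: D_def H_def)
        have "(x, y) \<in> L \<longleftrightarrow> (\<forall>m. \<exists>n\<ge>m. y \<in> A (I n x))"
          using elim(2) x sets_\<nu>[OF x] by (simp add: L_def space_pair_measure)
        also have "\<dots> \<longleftrightarrow> r < p x y"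
          using N by (metis max.cobounded1 max.cobounded2)
        finally show "(x, y) \<in> L \<longleftrightarrow> r < p x y" .
      qed
    qed
  qed
  ultimately show ?thesis by blast
qed

text \<open>Radon-Nikodym yields a density \<open>p x\<close> for each \<open>x\<close>, chosen
  independently of the others. A nonnegative number is the supremum of the nonnegative rationals up
  to it, so a jointly measurable version arises as a supremum of multiples of indicators of the
  threshold sets, one for each rational.\<close>

lemma joint_density_countably_generated:
  fixes \<mu> \<nu> :: "'a \<Rightarrow> 'b measure"
  assumes \<A>: "countable \<A>" "algebra (space Y) \<A>" "sets Y = sigma_sets (space Y) \<A>"
    and \<mu>: "finite_kernel X Y \<mu>" and \<nu>: "finite_kernel X Y \<nu>"
    and ac: "kernel_ac X \<mu> \<nu>"
  shows "\<exists>f\<in>borel_measurable (X \<Otimes>\<^sub>M Y). \<forall>x\<in>space X. \<mu> x = density (\<nu> x) (\<lambda>y. f (x, y))"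
proof -
  have "\<exists>q. q \<in> borel_measurable Y \<and> (\<forall>y. 0 \<le> q y) \<and> \<mu> x = density (\<nu> x) (\<lambda>y. ennreal (q y))"
    if x: "x \<in> space X" for x
  proof -
    note \<mu>x = finite_kernelD[OF \<mu> x] and \<nu>x = finite_kernelD[OF \<nu> x]
    interpret \<nu>: finite_measure "\<nu> x"
      by fact
    have acx: "absolutely_continuous (\<nu> x) (\<mu> x)" and sets: "sets (\<mu> x) = sets (\<nu> x)"
      using ac x \<mu>x \<nu>x by (auto simp: kernel_ac_def)
    obtain q where q: "q \<in> borel_measurable (\<nu> x)" "AE y in \<nu> x. RN_deriv (\<nu> x) (\<mu> x) y = ennreal (q y)"
        "\<And>y. 0 \<le> q y"
      using \<nu>.real_RN_deriv[OF \<mu>x(1) acx sets] by blast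
    have "\<mu> x = density (\<nu> x) (RN_deriv (\<nu> x) (\<mu> x))"
      using \<nu>.density_RN_deriv[OF acx sets] by simp
    also have "\<dots> = density (\<nu> x) (\<lambda>y. ennreal (q y))"
      using q by (intro density_cong) auto
    finally show ?thesis
      using q \<nu>x by (auto cong: measurable_cong_sets)
  qed
  then have "\<forall>x. \<exists>q. x \<in> space X \<longrightarrow> q \<in> borel_measurable Y \<and> (\<forall>y. 0 \<le> q y) \<and> \<mu> x = density (\<nu> x) (\<lambda>y. ennreal (q y))"
    by blast
  from choice[OF this] obtain p where p: "\<And>x. x \<in> space X \<Longrightarrow> p x \<in> borel_measurable Y"
      "\<And>x y. x \<in> space X \<Longrightarrow> 0 \<le> p x y"
      "\<And>x. x \<in> space X \<Longrightarrow> \<mu> x = density (\<nu> x) (\<lambda>y. ennreal (p x y))"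
    by blast
  \<comment> \<open>Truncation extends nonnegativity to \<open>x\<close> outside
    \<open>space X\<close>, where \<open>choice\<close> leaves \<open>p x\<close> arbitrary.\<close>
  define p' where "p' x y = max 0 (p x y)" for x y
  have p': "p' x = p x" if "x \<in> space X" for x
    using p(2)[OF that] by (auto simp: p'_def)
  have "\<forall>r. \<exists>L. L \<in> sets (X \<Otimes>\<^sub>M Y) \<and>
      (\<forall>x\<in>space X. AE y in \<nu> x. p' x y \<noteq> r \<longrightarrow> ((x, y) \<in> L \<longleftrightarrow> r < p' x y))"
    using p p'
    by (intro allI measurable_threshold_set[OF \<A> \<mu> \<nu>, unfolded Bex_def]) (auto simp: p'_def)
  from choice[OF this] obtain L where L: "\<And>r. L r \<in> sets (X \<Otimes>\<^sub>M Y)"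
      and L_iff: "\<And>r x. x \<in> space X \<Longrightarrow> AE y in \<nu> x. p' x y \<noteq> r \<longrightarrow> ((x, y) \<in> L r \<longleftrightarrow> r < p' x y)"
    by blast
  \<comment> \<open>Negative rationals contribute 0, since \<open>ennreal\<close> truncates them.
    Whether a point lies in the threshold set of a rational equal to \<open>p x y\<close> is
    immaterial: the contribution never exceeds \<open>p x y\<close>, and smaller rationals already
    yield the supremum.\<close>
  define f where "f z = (SUP r\<in>\<rat>. ennreal r * indicator (L r) z)" for z
  have "countable (\<rat> :: real set)"
    by (rule countable_rat)
  then have "f \<in> borel_measurable (X \<Otimes>\<^sub>M Y)"
    unfolding f_def using L by (intro borel_measurable_SUP) auto
  moreover have "\<mu> x = density (\<nu> x) (\<lambda>y. f (x, y))" if x: "x \<in> space X" for x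
  proof -
    have "AE y in \<nu> x. \<forall>r\<in>\<rat>. p' x y \<noteq> r \<longrightarrow> ((x, y) \<in> L r \<longleftrightarrow> r < p' x y)"
      using L_iff[OF x] by (simp add: AE_ball_countable countable_rat)
    then have "AE y in \<nu> x. ennreal (p x y) = f (x, y)"
    proof eventually_elim
      case (elim y)
      show ?case
      proof (rule antisym)
        show "f (x, y) \<le> ennreal (p x y)"
          unfolding f_def
        proof (rule SUP_least)
          fix r :: real assume "r \<in> \<rat>"
          then show "ennreal r * indicator (L r) (x, y) \<le> ennreal (p x y)"
            using elim p'[OF x] by (cases "r = p' x y") (auto split: split_indicator intro!: ennreal_leI)
        qed
        show "ennreal (p x y) \<le> f (x, y)"
        proof (rule ccontr)
          assume "\<not> ennreal (p x y) \<le> f (x, y)"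
          then have less: "f (x, y) < ennreal (p x y)"
            by simp
          then obtain t where t: "f (x, y) = ennreal t" "0 \<le> t"
            by (cases "f (x, y)") auto
          then have "t < p x y"
            using less by (simp add: ennreal_less_iff)
          then obtain r where r: "r \<in> \<rat>" "t < r" "r < p x y"
            using Rats_dense_in_real by blast
          then have "(x, y) \<in> L r"
            using elim p'[OF x] by auto
          then have "ennreal r \<le> f (x, y)"
            unfolding f_def using r(1) by (intro SUP_upper2[of r]) auto
          then show False
            using t r by simp
        qed
      qed
    qed
    moreover have "(\<lambda>y. f (x, y)) \<in> borel_measurable (\<nu> x)" "p x \<in> borel_measurable (\<nu> x)"
      using \<open>f \<in> _\<close> p(1)[OF x] x finite_kernelD[OF \<nu> x] by (auto cong: measurable_cong_sets)
    ultimately show ?thesis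
      unfolding p(3)[OF x] by (intro density_cong) auto
  qed
  ultimately show ?thesis by blast
qed

text \<open>Over a countable discrete \<open>X\<close>, joint measurability reduces to measurability
  in the second variable for each fixed \<open>x\<close>, so the Radon-Nikodym derivatives can be
  used as they are.\<close>

lemma joint_density_countable_discrete:
  fixes \<mu> \<nu> :: "'a \<Rightarrow> 'b measure"
  assumes X: "countable_discrete X"
    and \<mu>: "finite_kernel X Y \<mu>" and \<nu>: "finite_kernel X Y \<nu>"
    and ac: "kernel_ac X \<mu> \<nu>"
  shows "\<exists>f\<in>borel_measurable (X \<Otimes>\<^sub>M Y). \<forall>x\<in>space X. \<mu> x = density (\<nu> x) (\<lambda>y. f (x, y))"
proof (intro bexI ballI)
  let ?f = "\<lambda>(x, y). RN_deriv (\<nu> x) (\<mu> x) y"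
  show "\<mu> x = density (\<nu> x) (\<lambda>y. ?f (x, y))" if x: "x \<in> space X" for x
  proof -
    interpret \<nu>: finite_measure "\<nu> x"
      using finite_kernelD[OF \<nu> x] by simp
    show ?thesis
      using \<nu>.density_RN_deriv[of "\<mu> x"] ac x finite_kernelD[OF \<mu> x] finite_kernelD[OF \<nu> x]
      by (simp add: kernel_ac_def)
  qed
  have "?f \<in> borel_measurable (count_space (space X) \<Otimes>\<^sub>M Y)"
  proof (rule measurable_pair_measure_countable1)
    show "countable (space X)"
      using X by (simp add: countable_discrete_def)
    show "(\<lambda>y. ?f (x, y)) \<in> borel_measurable Y" if "x \<in> space X" for x
      using borel_measurable_RN_deriv[of "\<nu> x" "\<mu> x"] finite_kernelD[OF \<nu> that]
      by (simp cong: measurable_cong_sets)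
  qed
  moreover have "sets (count_space (space X) \<Otimes>\<^sub>M Y) = sets (X \<Otimes>\<^sub>M Y)"
    using X by (intro sets_pair_measure_cong) (auto simp: countable_discrete_def)
  ultimately show "?f \<in> borel_measurable (X \<Otimes>\<^sub>M Y)"
    by (simp cong: measurable_cong_sets)
qed

lemma joint_density:
  fixes \<mu> \<nu> :: "'a \<Rightarrow> 'b measure"
  assumes "countable_discrete X \<or> standard_borel Y"
    and "finite_kernel X Y \<mu>" and "finite_kernel X Y \<nu>" and "kernel_ac X \<mu> \<nu>"
  shows "\<exists>f\<in>borel_measurable (X \<Otimes>\<^sub>M Y). \<forall>x\<in>space X. \<mu> x = density (\<nu> x) (\<lambda>y. f (x, y))"
  using assms joint_density_countable_discrete joint_density_countably_generated
    standard_borel_countable_algebra by metis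

section \<open>Kernels\<close>

text \<open>The part of \<open>U\<close> where \<open>0 < g < n\<close> has finite mass under
  \<open>density M g\<close> because \<open>M\<close> is finite; in a 0-\<infinity>-set it is
  therefore null, and letting \<open>n\<close> grow leaves only the values 0 and \<infinity>.
  Conversely, if \<open>g\<close> takes just these values on \<open>U\<close>, then the mass of a
  subset is \<infinity> times the \<open>M\<close>-measure of its part with
  \<open>g = \<infinity>\<close>.\<close>

lemma (in finite_measure) zero_infty_set_density_iff:
  assumes g [measurable]: "g \<in> borel_measurable M"
  shows "zero_infty_set (density M g) U \<longleftrightarrow> U \<in> sets M \<and> (AE y in M. y \<in> U \<longrightarrow> g y = 0 \<or> g y = \<infinity>)"
proof (intro iffI conjI)
  assume *: "zero_infty_set (density M g) U"
  then show U [measurable]: "U \<in> sets M"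
    by (simp add: zero_infty_set_def)
  have "AE y in M. \<not> (y \<in> U \<and> 0 < g y \<and> g y < of_nat n)" for n :: nat
  proof -
    define V where "V = {y \<in> space M. y \<in> U \<and> 0 < g y \<and> g y < of_nat n}"
    have V [measurable]: "V \<in> sets M"
      unfolding V_def by measurable
    have "emeasure (density M g) V = (\<integral>\<^sup>+y. g y * indicator V y \<partial>M)"
      by (simp add: emeasure_density)
    also have "\<dots> \<le> (\<integral>\<^sup>+y. of_nat n * indicator V y \<partial>M)"
      by (intro nn_integral_mono) (auto simp: V_def split: split_indicator)
    also have "\<dots> = of_nat n * emeasure M V"
      by (simp add: nn_integral_cmult_indicator)
    also have "\<dots> < \<infinity>"
      by (simp add: ennreal_mult_eq_top_iff less_top[symmetric])
    finally have "emeasure (density M g) V < \<infinity>" .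
    moreover have "V \<subseteq> U"
      by (auto simp: V_def)
    ultimately have "emeasure (density M g) V = 0"
      using * V unfolding zero_infty_set_def by auto
    then have "V \<in> null_sets (density M g)"
      by (intro null_setsI) auto
    then have "AE y in M. y \<in> V \<longrightarrow> g y = 0"
      by (simp add: null_sets_density_iff)
    then show ?thesis
      using AE_space by eventually_elim (auto simp: V_def zero_less_iff_neq_zero)
  qed
  then have "AE y in M. \<forall>n::nat. \<not> (y \<in> U \<and> 0 < g y \<and> g y < of_nat n)"
    by (simp only: AE_all_countable) blast
  then show "AE y in M. y \<in> U \<longrightarrow> g y = 0 \<or> g y = \<infinity>"
  proof eventually_elim
    case (elim y)
    show ?case
    proof (rule ccontr)
      assume "\<not> (y \<in> U \<longrightarrow> g y = 0 \<or> g y = \<infinity>)"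
      then show False
        using elim ennreal_Ex_less_of_nat[of "g y"] by (auto simp: zero_less_iff_neq_zero less_top[symmetric])
    qed
  qed
next
  assume *: "U \<in> sets M \<and> (AE y in M. y \<in> U \<longrightarrow> g y = 0 \<or> g y = \<infinity>)"
  show "zero_infty_set (density M g) U"
    unfolding zero_infty_set_def
  proof (intro conjI ballI impI)
    show "U \<in> sets (density M g)"
      using * by simp
    fix V assume V: "V \<in> sets (density M g)" "V \<subseteq> U"
    then have [measurable]: "V \<in> sets M"
      by simp
    have "emeasure (density M g) V = (\<integral>\<^sup>+y. g y * indicator V y \<partial>M)"
      by (simp add: emeasure_density)
    also have "\<dots> = (\<integral>\<^sup>+y. \<infinity> * indicator {y \<in> space M. y \<in> V \<and> g y = \<infinity>} y \<partial>M)"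
      using * AE_space V(2) by (intro nn_integral_cong_AE) (auto elim!: eventually_mono eventually_rev_mp split: split_indicator)
    also have "\<dots> = \<infinity> * emeasure M {y \<in> space M. y \<in> V \<and> g y = \<infinity>}"
      by (intro nn_integral_cmult_indicator) measurable
    finally show "emeasure (density M g) V \<in> {0, \<infinity>}"
      by (auto simp: ennreal_top_mult)
  qed
qed

lemma absolutely_continuous_density:
  assumes [measurable]: "f \<in> borel_measurable M" "g \<in> borel_measurable M"
    and "AE y in M. g y = 0 \<longrightarrow> f y = 0"
  shows "absolutely_continuous (density M g) (density M f)"
  unfolding absolutely_continuous_def using assms(3)
  by (auto simp: null_sets_density_iff elim!: eventually_rev_mp)

section \<open>Measurability of sections and restriction of kernels\<close>

text \<open>Induction from rectangles to the product sigma-algebra. Finiteness of the measures lets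
  the value on a complement be written as a difference.\<close>

lemma measurable_emeasure_section:
  assumes k: "finite_kernel X Y k" and C: "C \<in> sets (X \<Otimes>\<^sub>M Y)"
  shows "(\<lambda>x. emeasure (k x) (Pair x -` C)) \<in> borel_measurable X" (is "?s C \<in> _")
proof -
  have kern: "kernel X Y k"
    using k by (rule finite_kernel_kernel)
  have sec: "Pair x -` A \<in> sets (k x)" if "x \<in> space X" "A \<in> sets (X \<Otimes>\<^sub>M Y)" for x A
    using that finite_kernelD[OF k] by (simp add: sets_Pair1)
  show ?thesis
    using Int_stable_pair_measure_generator pair_measure_closed C
    unfolding sets_pair_measure
  proof (induct rule: sigma_sets_induct_disjoint)
    case (basic A)
    then obtain a b where A: "A = a \<times> b" "a \<in> sets X" "b \<in> sets Y"
      by auto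
    have "?s A = (\<lambda>x. emeasure (k x) b * indicator a x)"
      by (auto simp: A fun_eq_iff split: split_indicator)
    then show ?case
      using A kernel_measurable[OF kern] by simp
  next
    case empty
    then show ?case by simp
  next
    case (compl A)
    then have A: "A \<in> sets (X \<Otimes>\<^sub>M Y)"
      by (simp add: sets_pair_measure)
    have "?s (space X \<times> space Y - A) x = emeasure (k x) (space Y) - ?s A x" if x: "x \<in> space X" for x
    proof -
      interpret finite_measure "k x"
        using finite_kernelD[OF k x] by simp
      have "Pair x -` (space X \<times> space Y - A) = space (k x) - Pair x -` A"
        using x finite_kernelD[OF k x] by auto
      then show ?thesis
        using emeasure_compl[OF sec[OF x A]] finite_kernelD[OF k x] by simp
    qed
    then show ?case
      using compl kernel_measurable[OF kern, of "space Y"] by (simp cong: measurable_cong)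
  next
    case (union F)
    then have F: "F i \<in> sets (X \<Otimes>\<^sub>M Y)" for i
      by (auto simp: sets_pair_measure)
    have "?s (\<Union>i. F i) x = (\<Sum>i. ?s (F i) x)" if x: "x \<in> space X" for x
    proof -
      have "(\<Sum>i. emeasure (k x) (Pair x -` F i)) = emeasure (k x) (\<Union>i. Pair x -` F i)"
        using F x union(1) by (intro suminf_emeasure) (auto intro!: sec simp: disjoint_family_on_def)
      then show ?thesis
        by (simp add: vimage_UN)
    qed
    then show ?case
      using union by (simp cong: measurable_cong)
  qed
qed

text \<open>The density with respect to an indicator keeps the space and sigma-algebra of
  \<open>k x\<close>, so that the result can again be a kernel into \<open>Y\<close>.\<close>

definition kernel_restrict :: "('a \<Rightarrow> 'b measure) \<Rightarrow> ('a \<times> 'b) set \<Rightarrow> 'a \<Rightarrow> 'b measure" where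
  "kernel_restrict k C x = density (k x) (indicator (Pair x -` C))"

lemma sets_kernel_restrict [simp]: "sets (kernel_restrict k C x) = sets (k x)"
  by (simp add: kernel_restrict_def)

lemma emeasure_kernel_restrict:
  assumes "kernel X Y k" "C \<in> sets (X \<Otimes>\<^sub>M Y)" "x \<in> space X" "B \<in> sets Y"
  shows "emeasure (kernel_restrict k C x) B = emeasure (k x) (B \<inter> Pair x -` C)"
proof -
  have [measurable]: "Pair x -` C \<in> sets (k x)" "B \<in> sets (k x)"
    using assms kernel_sets[OF assms(1,3)] by (auto simp: sets_Pair1)
  show ?thesis
    unfolding kernel_restrict_def
    by (subst emeasure_density) (auto simp: Int_commute simp flip: indicator_inter_arith)
qed

lemma finite_kernel_restrict:
  assumes k: "finite_kernel X Y k" and C: "C \<in> sets (X \<Otimes>\<^sub>M Y)"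
  shows "finite_kernel X Y (kernel_restrict k C)"
proof -
  note kern = finite_kernel_kernel[OF k]
  have "(SUP x\<in>space X. emeasure (kernel_restrict k C x) (space Y)) \<le> (SUP x\<in>space X. emeasure (k x) (space Y))"
    using kernel_sets[OF kern]
    by (intro SUP_mono) (auto simp: emeasure_kernel_restrict[OF kern C] intro!: bexI emeasure_mono)
  then have "(SUP x\<in>space X. emeasure (kernel_restrict k C x) (space Y)) < \<infinity>"
    using k by (auto simp: finite_kernel_def intro: le_less_trans)
  moreover have "(\<lambda>x. emeasure (kernel_restrict k C x) B) \<in> borel_measurable X" if B: "B \<in> sets Y" for B
  proof -
    have eq: "emeasure (kernel_restrict k C x) B = emeasure (k x) (Pair x -` (space X \<times> B \<inter> C))"
      if x: "x \<in> space X" for x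
      using x by (auto simp: emeasure_kernel_restrict[OF kern C x B] intro!: arg_cong[where f = "emeasure (k x)"])
    have "space X \<times> B \<inter> C \<in> sets (X \<Otimes>\<^sub>M Y)"
      using B C by auto
    from measurable_emeasure_section[OF k this] show ?thesis
      by (subst measurable_cong[OF eq])
  qed
  ultimately show ?thesis
    using kernel_sets[OF kern] by (auto simp: finite_kernel_def kernel_def)
qed

lemma kernel_suminf_measurable:
  assumes "\<And>i. kernel X Y (ki i)" and "kernel_suminf X Y ki k"
    and "\<And>x. x \<in> space X \<Longrightarrow> sets (k x) = sets Y"
  shows "kernel X Y k"
  unfolding kernel_def
proof (intro conjI ballI)
  fix B assume B: "B \<in> sets Y"
  have "(\<lambda>x. \<Sum>i. emeasure (ki i x) B) \<in> borel_measurable X"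
    using kernel_measurable[OF assms(1) B] by simp
  then show "(\<lambda>x. emeasure (k x) B) \<in> borel_measurable X"
    using assms(2) B by (simp add: kernel_suminf_def cong: measurable_cong)
qed (use assms in auto)

text \<open>Each finite summand is restricted separately; measurability in \<open>x\<close> is known
  for these, and for the restricted \<open>k\<close> it follows by countable summation.\<close>

lemma s_finite_kernel_restrict:
  assumes k: "s_finite_kernel X Y k" and C: "C \<in> sets (X \<Otimes>\<^sub>M Y)"
  shows "s_finite_kernel X Y (kernel_restrict k C)"
proof -
  obtain ki where ki: "\<And>i. finite_kernel X Y (ki i)" and sum: "kernel_suminf X Y ki k"
    using k unfolding s_finite_kernel_def by blast
  have kern: "kernel X Y k"
    using k by (simp add: s_finite_kernel_def)
  have fin: "finite_kernel X Y (kernel_restrict (ki i) C)" for i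
    using ki C by (rule finite_kernel_restrict)
  have sum': "kernel_suminf X Y (\<lambda>i. kernel_restrict (ki i) C) (kernel_restrict k C)"
    unfolding kernel_suminf_def
  proof (intro ballI)
    fix x B assume x: "x \<in> space X" and B: "B \<in> sets Y"
    then have "B \<inter> Pair x -` C \<in> sets Y"
      using C by (auto simp: sets_Pair1)
    then show "emeasure (kernel_restrict k C x) B = (\<Sum>i. emeasure (kernel_restrict (ki i) C x) B)"
      using sum x by (simp add: emeasure_kernel_restrict[OF _ C x B] kern finite_kernel_kernel[OF ki] kernel_suminf_def)
  qed
  show ?thesis
    using fin sum' kernel_suminf_measurable[OF finite_kernel_kernel[OF fin] sum'] kernel_sets[OF kern]
    unfolding s_finite_kernel_def by (auto intro: exI[of _ "\<lambda>i. kernel_restrict (ki i) C"])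
qed

lemma supported_in_kernel_restrict:
  assumes "kernel X Y k" "C \<in> sets (X \<Otimes>\<^sub>M Y)"
  shows "supported_in X Y (kernel_restrict k C) C"
  unfolding supported_in_def
proof (intro conjI ballI)
  fix x assume x: "x \<in> space X"
  then have "space Y - Pair x -` C \<in> sets Y"
    using assms(2) by (auto simp: sets_Pair1)
  moreover have "(space Y - Pair x -` C) \<inter> Pair x -` C = {}"
    by auto
  ultimately show "emeasure (kernel_restrict k C x) (space Y - Pair x -` C) = 0"
    using emeasure_kernel_restrict[OF assms x] by simp
qed fact

text \<open>\<open>C\<close> itself separates the kernels, as \<open>l\<close> is carried by
  \<open>D\<close>, which avoids \<open>C\<close>.\<close>

lemma mutually_singular_if_disjoint_supports:
  assumes "supported_in X Y k C" "supported_in X Y l D" "C \<inter> D = {}"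
    and l: "kernel X Y l"
  shows "mutually_singular X Y k l"
  unfolding mutually_singular_def
proof (intro bexI conjI)
  show C: "C \<in> sets (X \<Otimes>\<^sub>M Y)"
    using assms by (simp add: supported_in_def)
  show "supported_in X Y k C"
    by fact
  have "emeasure (l x) (space Y - Pair x -` (space (X \<Otimes>\<^sub>M Y) - C)) = 0" if x: "x \<in> space X" for x
  proof -
    have "emeasure (l x) (space Y - Pair x -` (space (X \<Otimes>\<^sub>M Y) - C)) \<le> emeasure (l x) (space Y - Pair x -` D)"
      using assms(2,3) x kernel_sets[OF l x]
      by (intro emeasure_mono) (auto simp: space_pair_measure supported_in_def sets_Pair1)
    also have "\<dots> = 0"
      using assms(2) x by (simp add: supported_in_def)
    finally show ?thesis
      by simp
  qed
  then show "supported_in X Y l (space (X \<Otimes>\<^sub>M Y) - C)"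
    using C by (auto simp: supported_in_def)
qed

section \<open>A common dominating kernel and densities of s-finite kernels\<close>

lemma suminf_commute_ennreal:
  fixes f :: "nat \<Rightarrow> nat \<Rightarrow> ennreal"
  shows "(\<Sum>i. \<Sum>j. f i j) = (\<Sum>j. \<Sum>i. f i j)"
  using nn_integral_suminf[of "\<lambda>j i. f i j" "count_space UNIV"] by (simp add: nn_integral_count_space_nat)

text \<open>A sum of the \<open>m n\<close> with positive weights has as null sets exactly the
  common null sets of the summands. The weights are small enough for the total mass to be at most 1
  at every \<open>x\<close>.\<close>

lemma dominating_finite_kernel:
  fixes m :: "nat \<Rightarrow> 'a \<Rightarrow> 'b measure"
  assumes m: "\<And>n. finite_kernel X Y (m n)"
  obtains \<nu> where "finite_kernel X Y \<nu>" "\<And>n. kernel_ac X (m n) \<nu>"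
proof -
  \<comment> \<open>\<open>r n\<close> bounds the mass of \<open>m n\<close>;
    \<open>enn2real\<close> loses nothing, as the supremum is finite. The summand 1 in the
    denominator of \<open>c n\<close> keeps the weight positive when \<open>r n = 0\<close>, and the
    factors \<open>(1/2)^Suc n\<close> sum to 1.\<close>
  define r where "r n = enn2real (SUP x\<in>space X. emeasure (m n x) (space Y))" for n
  define c where "c n = ennreal ((1/2)^Suc n / (1 + r n))" for n
  define \<nu> where "\<nu> x = measure_of (space Y) (sets Y) (\<lambda>B. \<Sum>n. c n * emeasure (m n x) B)" for x
  have r: "0 \<le> r n" for n
    by (simp add: r_def)
  have c_pos: "c n \<noteq> 0" for n
    using r[of n] by (simp add: c_def)
  have sets_\<nu>: "sets (\<nu> x) = sets Y" for x
    by (simp add: \<nu>_def)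
  have em: "emeasure (\<nu> x) B = (\<Sum>n. c n * emeasure (m n x) B)" if x: "x \<in> space X" and B: "B \<in> sets Y" for x B
    unfolding \<nu>_def
  proof (rule emeasure_measure_of_sigma)
    show "sigma_algebra (space Y) (sets Y)"
      by (rule sets.sigma_algebra_axioms)
    show "positive (sets Y) (\<lambda>B. \<Sum>n. c n * emeasure (m n x) B)"
      by (simp add: positive_def)
    show "countably_additive (sets Y) (\<lambda>B. \<Sum>n. c n * emeasure (m n x) B)"
    proof (rule countably_additiveI)
      fix A :: "nat \<Rightarrow> 'b set" assume A: "range A \<subseteq> sets Y" "disjoint_family A"
      have "(\<Sum>i. emeasure (m n x) (A i)) = emeasure (m n x) (\<Union>i. A i)" for n
        using A finite_kernelD[OF m x] by (intro suminf_emeasure) auto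
      then show "(\<Sum>i. \<Sum>n. c n * emeasure (m n x) (A i)) = (\<Sum>n. c n * emeasure (m n x) (\<Union>i. A i))"
        by (subst suminf_commute_ennreal) simp
    qed
  qed fact
  have bound: "emeasure (\<nu> x) (space Y) \<le> 1" if x: "x \<in> space X" for x
  proof -
    have "c n * emeasure (m n x) (space Y) \<le> ennreal ((1/2)^Suc n)" for n
    proof -
      have "emeasure (m n x) (space Y) \<le> (SUP x\<in>space X. emeasure (m n x) (space Y))"
        using x by (rule SUP_upper)
      also have "\<dots> = ennreal (r n)"
        using m[of n] by (simp add: r_def finite_kernel_def ennreal_enn2real)
      finally have "c n * emeasure (m n x) (space Y) \<le> c n * ennreal (r n)"
        by (rule mult_left_mono) simp
      also have "\<dots> = ennreal ((1/2)^Suc n * (r n / (1 + r n)))"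
        using r[of n] by (simp add: c_def flip: ennreal_mult)
      also have "\<dots> \<le> ennreal ((1/2)^Suc n * 1)"
        using r[of n] by (intro ennreal_leI mult_left_mono) (auto simp: field_simps)
      finally show ?thesis
        by simp
    qed
    then have "(\<Sum>n. c n * emeasure (m n x) (space Y)) \<le> (\<Sum>n. ennreal ((1/2)^Suc n))"
      by (intro suminf_le summableI)
    also have "\<dots> = 1"
      using power_half_series by (subst suminf_ennreal_eq[of _ 1]) auto
    finally show ?thesis
      using em[OF x] by simp
  qed
  show thesis
  proof
    have "(SUP x\<in>space X. emeasure (\<nu> x) (space Y)) \<le> 1"
      using bound by (rule SUP_least)
    moreover have "(\<lambda>x. emeasure (\<nu> x) B) \<in> borel_measurable X" if "B \<in> sets Y" for B
    proof -
      have "(\<lambda>x. \<Sum>n. c n * emeasure (m n x) B) \<in> borel_measurable X"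
        using kernel_measurable[OF finite_kernel_kernel[OF m] that] by simp
      then show ?thesis
        using em that by (simp cong: measurable_cong)
    qed
    ultimately show "finite_kernel X Y \<nu>"
      unfolding finite_kernel_def kernel_def using sets_\<nu> by (auto intro: le_less_trans)
    show "kernel_ac X (m n) \<nu>" for n
      unfolding kernel_ac_def absolutely_continuous_def
    proof (intro ballI subsetI)
      fix x B assume x: "x \<in> space X" and B: "B \<in> null_sets (\<nu> x)"
      then have BY: "B \<in> sets Y" and "(\<Sum>n. c n * emeasure (m n x) B) = 0"
        using em[OF x, of B] sets_\<nu> by (auto simp: null_sets_def)
      then have "c n * emeasure (m n x) B = 0"
        by (subst (asm) suminf_eq_zero_iff) auto
      then show "B \<in> null_sets (m n x)"
        using c_pos BY finite_kernelD[OF m x] by (auto simp: null_sets_def)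
    qed
  qed
qed

text \<open>Monotone convergence moves the sum inside the integral. The summed density may take the
  value \<infinity>, since \<open>k\<close> need not be finite.\<close>

lemma kernel_suminf_density:
  fixes \<nu> :: "'a \<Rightarrow> 'b measure" and fi :: "nat \<Rightarrow> 'a \<times> 'b \<Rightarrow> ennreal"
  assumes k: "kernel X Y k" and sum: "kernel_suminf X Y ki k"
    and \<nu>: "kernel X Y \<nu>"
    and fi: "\<And>i. fi i \<in> borel_measurable (X \<Otimes>\<^sub>M Y)"
    and ki: "\<And>i x. x \<in> space X \<Longrightarrow> ki i x = density (\<nu> x) (\<lambda>y. fi i (x, y))"
    and x: "x \<in> space X"
  shows "k x = density (\<nu> x) (\<lambda>y. \<Sum>i. fi i (x, y))"
proof (rule measure_eqI)
  show sets: "sets (k x) = sets (density (\<nu> x) (\<lambda>y. \<Sum>i. fi i (x, y)))"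
    using kernel_sets[OF k x] kernel_sets[OF \<nu> x] by simp
  fix B assume "B \<in> sets (k x)"
  then have B: "B \<in> sets Y" and B' [measurable]: "B \<in> sets (\<nu> x)"
    using kernel_sets[OF k x] kernel_sets[OF \<nu> x] by auto
  have [measurable]: "(\<lambda>y. fi i (x, y)) \<in> borel_measurable (\<nu> x)" for i
    using fi x kernel_sets[OF \<nu> x] by (simp cong: measurable_cong_sets)
  have "emeasure (k x) B = (\<Sum>i. \<integral>\<^sup>+y. fi i (x, y) * indicator B y \<partial>\<nu> x)"
    using sum x B ki by (simp add: kernel_suminf_def emeasure_density)
  also have "\<dots> = (\<integral>\<^sup>+y. (\<Sum>i. fi i (x, y)) * indicator B y \<partial>\<nu> x)"
    by (subst nn_integral_suminf[symmetric]) auto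
  also have "\<dots> = emeasure (density (\<nu> x) (\<lambda>y. \<Sum>i. fi i (x, y))) B"
    by (simp add: emeasure_density)
  finally show "emeasure (k x) B = emeasure (density (\<nu> x) (\<lambda>y. \<Sum>i. fi i (x, y))) B" .
qed

lemma s_finite_joint_densities:
  fixes k l :: "'a \<Rightarrow> 'b measure"
  assumes XY: "countable_discrete X \<or> standard_borel Y"
    and k: "s_finite_kernel X Y k" and l: "s_finite_kernel X Y l"
  obtains \<nu> f g where "finite_kernel X Y \<nu>"
    "f \<in> borel_measurable (X \<Otimes>\<^sub>M Y)" "\<And>x. x \<in> space X \<Longrightarrow> k x = density (\<nu> x) (\<lambda>y. f (x, y))"
    "g \<in> borel_measurable (X \<Otimes>\<^sub>M Y)" "\<And>x. x \<in> space X \<Longrightarrow> l x = density (\<nu> x) (\<lambda>y. g (x, y))"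
proof -
  obtain ki where ki: "\<And>i. finite_kernel X Y (ki i)" "kernel_suminf X Y ki k"
    using k unfolding s_finite_kernel_def by blast
  obtain li where li: "\<And>i. finite_kernel X Y (li i)" "kernel_suminf X Y li l"
    using l unfolding s_finite_kernel_def by blast
  \<comment> \<open>Interleaving the two sequences gives one \<open>\<nu>\<close> for both:
    \<open>ki i\<close> sits at index \<open>2 * i\<close> and \<open>li i\<close> at
    \<open>Suc (2 * i)\<close>.\<close>
  define m where "m n = (if even n then ki (n div 2) else li (n div 2))" for n :: nat
  have "finite_kernel X Y (m n)" for n
    using ki li by (simp add: m_def)
  then obtain \<nu> where \<nu>: "finite_kernel X Y \<nu>" and ac: "\<And>n. kernel_ac X (m n) \<nu>"
    using dominating_finite_kernel[of X Y m] by metis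
  have "kernel_ac X (ki i) \<nu>" for i
    using ac[of "2 * i"] by (simp add: m_def)
  then have "\<forall>i. \<exists>f. f \<in> borel_measurable (X \<Otimes>\<^sub>M Y) \<and> (\<forall>x\<in>space X. ki i x = density (\<nu> x) (\<lambda>y. f (x, y)))"
    using joint_density[OF XY ki(1) \<nu>] by blast
  from choice[OF this] obtain fi where fi: "\<And>i. fi i \<in> borel_measurable (X \<Otimes>\<^sub>M Y)"
      "\<And>i x. x \<in> space X \<Longrightarrow> ki i x = density (\<nu> x) (\<lambda>y. fi i (x, y))"
    by blast
  have "kernel_ac X (li i) \<nu>" for i
    using ac[of "Suc (2 * i)"] by (simp add: m_def)
  then have "\<forall>i. \<exists>g. g \<in> borel_measurable (X \<Otimes>\<^sub>M Y) \<and> (\<forall>x\<in>space X. li i x = density (\<nu> x) (\<lambda>y. g (x, y)))"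
    using joint_density[OF XY li(1) \<nu>] by blast
  from choice[OF this] obtain gi where gi: "\<And>i. gi i \<in> borel_measurable (X \<Otimes>\<^sub>M Y)"
      "\<And>i x. x \<in> space X \<Longrightarrow> li i x = density (\<nu> x) (\<lambda>y. gi i (x, y))"
    by blast
  have kern: "kernel X Y k" "kernel X Y l"
    using k l by (auto simp: s_finite_kernel_def)
  note \<nu>' = finite_kernel_kernel[OF \<nu>]
  show thesis
  proof
    show "k x = density (\<nu> x) (\<lambda>y. (\<lambda>z. \<Sum>i. fi i z) (x, y))" if "x \<in> space X" for x
      using kernel_suminf_density[OF kern(1) ki(2) \<nu>' fi that] .
    show "l x = density (\<nu> x) (\<lambda>y. (\<lambda>z. \<Sum>i. gi i z) (x, y))" if "x \<in> space X" for x
      using kernel_suminf_density[OF kern(2) li(2) \<nu>' gi that] .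
  qed (use \<nu> fi gi in auto)
qed

section \<open>Existence\<close>

text \<open>\<open>C\<close> is sliced by the integer part of \<open>f\<close>. On slice
  \<open>n\<close> the density is at most \<open>n + 1\<close>, so the restriction has at most
  \<open>n + 1\<close> times the mass of \<open>\<nu>\<close>. The slices are disjoint, which makes
  the restrictions mutually singular.\<close>

lemma sigma_finite_kernel_restrict_density:
  fixes k :: "'a \<Rightarrow> 'b measure"
  assumes k: "s_finite_kernel X Y k" and \<nu>: "finite_kernel X Y \<nu>"
    and f [measurable]: "f \<in> borel_measurable (X \<Otimes>\<^sub>M Y)"
    and kf: "\<And>x. x \<in> space X \<Longrightarrow> k x = density (\<nu> x) (\<lambda>y. f (x, y))"
    and C: "C \<in> sets (X \<Otimes>\<^sub>M Y)" and finite: "\<And>z. z \<in> C \<Longrightarrow> f z < \<infinity>"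
  shows "sigma_finite_kernel X Y (kernel_restrict k C)"
proof -
  \<comment> \<open>\<open>enn2real\<close> sends \<open>\<infinity>\<close> to 0, which is harmless here because \<open>f\<close> is finite on \<open>C\<close>.\<close>
  define E where "E n = {z \<in> space (X \<Otimes>\<^sub>M Y). z \<in> C \<and> nat \<lfloor>enn2real (f z)\<rfloor> = n}" for n
  have E [measurable]: "E n \<in> sets (X \<Otimes>\<^sub>M Y)" for n
    using C unfolding E_def by measurable
  have E_bound: "f z \<le> of_nat (Suc n)" if "z \<in> E n" for z n
  proof -
    have "f z = ennreal (enn2real (f z))"
      using finite[of z] that by (simp add: E_def ennreal_enn2real)
    also have "\<dots> \<le> ennreal (real (Suc n))"
      using that by (intro ennreal_leI) (auto simp: E_def, linarith)
    finally show ?thesis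
      by (simp only: ennreal_of_nat_eq_real_of_nat)
  qed
  have kern: "kernel X Y k"
    using k by (simp add: s_finite_kernel_def)
  define ki where "ki n = kernel_restrict k (E n)" for n
  have ki_kern: "kernel X Y (ki n)" for n
    using s_finite_kernel_restrict[OF k E] by (simp add: ki_def s_finite_kernel_def)
  have fin: "finite_kernel X Y (ki n)" for n
  proof -
    have "emeasure (ki n x) (space Y) \<le> of_nat (Suc n) * (SUP x\<in>space X. emeasure (\<nu> x) (space Y))"
      if x: "x \<in> space X" for x
    proof -
      note \<nu>x = finite_kernelD[OF \<nu> x]
      have [measurable]: "(\<lambda>y. f (x, y)) \<in> borel_measurable (\<nu> x)" "Pair x -` E n \<in> sets (\<nu> x)"
        using f x \<nu>x sets_Pair1[OF E] by (auto cong: measurable_cong_sets)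
      have "emeasure (ki n x) (space Y) = emeasure (k x) (Pair x -` E n)"
        using sets.sets_into_space[OF E[of n]] unfolding ki_def
        by (subst emeasure_kernel_restrict[OF kern E x])
           (auto simp: space_pair_measure intro!: arg_cong[where f = "emeasure (k x)"])
      also have "\<dots> = (\<integral>\<^sup>+y. f (x, y) * indicator (Pair x -` E n) y \<partial>\<nu> x)"
        unfolding kf[OF x] by (rule emeasure_density) measurable
      also have "\<dots> \<le> (\<integral>\<^sup>+y. of_nat (Suc n) \<partial>\<nu> x)"
        using E_bound by (intro nn_integral_mono) (auto split: split_indicator)
      also have "\<dots> = of_nat (Suc n) * emeasure (\<nu> x) (space Y)"
        using \<nu>x by simp
      also have "\<dots> \<le> of_nat (Suc n) * (SUP x\<in>space X. emeasure (\<nu> x) (space Y))"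
        using x by (intro mult_left_mono SUP_upper) auto
      finally show ?thesis .
    qed
    then have "(SUP x\<in>space X. emeasure (ki n x) (space Y))
        \<le> of_nat (Suc n) * (SUP x\<in>space X. emeasure (\<nu> x) (space Y))"
      by (rule SUP_least)
    also have "\<dots> < \<infinity>"
      using \<nu> unfolding finite_kernel_def
      by (auto simp: ennreal_mult_eq_top_iff less_top[symmetric] simp del: of_nat_Suc)
    finally show ?thesis
      using ki_kern by (simp add: finite_kernel_def)
  qed
  have "kernel_suminf X Y ki (kernel_restrict k C)"
    unfolding kernel_suminf_def
  proof (intro ballI)
    fix x B assume x: "x \<in> space X" and B: "B \<in> sets Y"
    have "(\<Sum>n. emeasure (ki n x) B) = (\<Sum>n. emeasure (k x) (B \<inter> Pair x -` E n))"
      unfolding ki_def by (simp add: emeasure_kernel_restrict[OF kern E x B])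
    also have "\<dots> = emeasure (k x) (\<Union>n. B \<inter> Pair x -` E n)"
      using B kernel_sets[OF kern x] sets_Pair1[OF E]
      by (intro suminf_emeasure) (auto simp: disjoint_family_on_def E_def)
    also have "(\<Union>n. B \<inter> Pair x -` E n) = B \<inter> Pair x -` C"
      using sets.sets_into_space[OF C] by (auto simp: E_def)
    finally show "emeasure (kernel_restrict k C x) B = (\<Sum>n. emeasure (ki n x) B)"
      using emeasure_kernel_restrict[OF kern C x B] by simp
  qed
  moreover have "mutually_singular X Y (ki i) (ki j)" if "i \<noteq> j" for i j
    using that supported_in_kernel_restrict[OF kern E] ki_kern
    by (intro mutually_singular_if_disjoint_supports[of _ _ _ "E i" _ "E j"]) (auto simp: ki_def E_def)
  moreover have "kernel X Y (kernel_restrict k C)"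
    using s_finite_kernel_restrict[OF k C] by (simp add: s_finite_kernel_def)
  ultimately show ?thesis
    unfolding sigma_finite_kernel_def using fin by (intro conjI exI[of _ ki]) auto
qed

lemma exists_lebesgue_decomposition:
  fixes k l :: "'a \<Rightarrow> 'b measure"
  assumes XY: "countable_discrete X \<or> standard_borel Y"
    and k: "s_finite_kernel X Y k" and l: "s_finite_kernel X Y l"
  obtains ka kinf ks where "lebesgue_decomposition X Y k l ka kinf ks"
    "s_finite_kernel X Y ka" "sigma_finite_kernel X Y kinf" "s_finite_kernel X Y ks"
proof -
  obtain \<nu> f g where \<nu>: "finite_kernel X Y \<nu>"
    and f [measurable]: "f \<in> borel_measurable (X \<Otimes>\<^sub>M Y)"
    and kf: "\<And>x. x \<in> space X \<Longrightarrow> k x = density (\<nu> x) (\<lambda>y. f (x, y))"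
    and g [measurable]: "g \<in> borel_measurable (X \<Otimes>\<^sub>M Y)"
    and lg: "\<And>x. x \<in> space X \<Longrightarrow> l x = density (\<nu> x) (\<lambda>y. g (x, y))"
    by (rule s_finite_joint_densities[OF XY k l]) (rule that)
  define S where "S = {z \<in> space (X \<Otimes>\<^sub>M Y). g z = 0}"
  define T where "T = {z \<in> space (X \<Otimes>\<^sub>M Y). g z = \<infinity> \<and> f z < \<infinity>}"
  \<comment> \<open>\<open>A\<close> consists of \<open>{0 < g < \<infinity>}\<close> and
    \<open>{f = g = \<infinity>}\<close>. The latter is kept out of \<open>T\<close>, because a set
    of positive \<open>\<nu> x\<close>-measure with \<open>f = \<infinity>\<close> would give the
    restriction to \<open>T\<close> a nontrivial 0-\<infinity>-set.\<close>
  define A where "A = {z \<in> space (X \<Otimes>\<^sub>M Y). g z \<noteq> 0 \<and> \<not> (g z = \<infinity> \<and> f z < \<infinity>)}"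
  have S [measurable]: "S \<in> sets (X \<Otimes>\<^sub>M Y)" and T [measurable]: "T \<in> sets (X \<Otimes>\<^sub>M Y)"
    and A [measurable]: "A \<in> sets (X \<Otimes>\<^sub>M Y)"
    unfolding S_def T_def A_def by measurable
  have kern_k: "kernel X Y k" and kern_l: "kernel X Y l"
    using k l by (auto simp: s_finite_kernel_def)
  note sfin = s_finite_kernel_restrict[OF k]
  have kern: "kernel X Y (kernel_restrict k C)" if "C \<in> sets (X \<Otimes>\<^sub>M Y)" for C
    using sfin[OF that] by (simp add: s_finite_kernel_def)
  note supp = supported_in_kernel_restrict[OF kern_k]
  have meas [measurable]: "(\<lambda>y. f (x, y)) \<in> borel_measurable (\<nu> x)" "(\<lambda>y. g (x, y)) \<in> borel_measurable (\<nu> x)"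
    if "x \<in> space X" for x
    using that f g finite_kernelD[OF \<nu> that] by (auto cong: measurable_cong_sets)
  have sec: "Pair x -` C \<in> sets (\<nu> x)" if "C \<in> sets (X \<Otimes>\<^sub>M Y)" "x \<in> space X" for x C
    using that finite_kernelD[OF \<nu> that(2)] by (simp add: sets_Pair1)
  have restr: "kernel_restrict k C x = density (\<nu> x) (\<lambda>y. f (x, y) * indicator C (x, y))"
    and restr_meas: "(\<lambda>y. f (x, y) * indicator C (x, y)) \<in> borel_measurable (\<nu> x)"
    if C: "C \<in> sets (X \<Otimes>\<^sub>M Y)" and x: "x \<in> space X" for C x
  proof -
    have ind: "indicator C (x, y) = indicator (Pair x -` C) y" for y
      by (auto split: split_indicator)
    show "(\<lambda>y. f (x, y) * indicator C (x, y)) \<in> borel_measurable (\<nu> x)"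
      unfolding ind using meas(1)[OF x] sec[OF C x] by auto
    show "kernel_restrict k C x = density (\<nu> x) (\<lambda>y. f (x, y) * indicator C (x, y))"
      unfolding kernel_restrict_def kf[OF x] ind
      using meas(1)[OF x] sec[OF C x] by (subst density_density_eq) auto
  qed
  \<comment> \<open>\<open>S\<close> is the zero set of \<open>g\<close>, so on a set disjoint from
    \<open>S\<close> the restricted density vanishes wherever \<open>g\<close> does.\<close>
  have ac: "kernel_ac X (kernel_restrict k C) l" if C: "C \<in> sets (X \<Otimes>\<^sub>M Y)" and "C \<inter> S = {}" for C
    unfolding kernel_ac_def
  proof
    fix x assume x: "x \<in> space X"
    show "absolutely_continuous (l x) (kernel_restrict k C x)"
      unfolding lg[OF x] restr[OF C x]
    proof (rule absolutely_continuous_density)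
      show "AE y in \<nu> x. g (x, y) = 0 \<longrightarrow> f (x, y) * indicator C (x, y) = 0"
        using AE_space
      proof eventually_elim
        case (elim y)
        then show ?case
          using that(2) x finite_kernelD[OF \<nu> x] by (auto simp: S_def space_pair_measure split: split_indicator)
      qed
    qed (use meas x restr_meas[OF C x] in auto)
  qed
  show thesis
  proof
    show "s_finite_kernel X Y (kernel_restrict k A)" "s_finite_kernel X Y (kernel_restrict k S)"
      using sfin A S by auto
    show "sigma_finite_kernel X Y (kernel_restrict k T)"
      by (rule sigma_finite_kernel_restrict_density[OF k \<nu> f kf T]) (auto simp: T_def)
    show "lebesgue_decomposition X Y k l (kernel_restrict k A) (kernel_restrict k T) (kernel_restrict k S)"
      unfolding lebesgue_decomposition_def
    proof (intro conjI ballI)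
      show "kernel X Y (kernel_restrict k A)" "kernel X Y (kernel_restrict k T)" "kernel X Y (kernel_restrict k S)"
        using kern A S T by auto
      show "mutually_singular X Y (kernel_restrict k A) (kernel_restrict k T)"
        by (rule mutually_singular_if_disjoint_supports[OF supp[OF A] supp[OF T] _ kern[OF T]]) (auto simp: A_def T_def)
      show "mutually_singular X Y (kernel_restrict k A) (kernel_restrict k S)"
        by (rule mutually_singular_if_disjoint_supports[OF supp[OF A] supp[OF S] _ kern[OF S]]) (auto simp: A_def S_def)
      show "mutually_singular X Y (kernel_restrict k T) (kernel_restrict k S)"
        by (rule mutually_singular_if_disjoint_supports[OF supp[OF T] supp[OF S] _ kern[OF S]]) (auto simp: T_def S_def)
      show "mutually_singular X Y (kernel_restrict k S) l"
      proof (rule mutually_singular_if_disjoint_supports[OF supp[OF S] _ _ kern_l])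
        show "supported_in X Y l (space (X \<Otimes>\<^sub>M Y) - S)"
          unfolding supported_in_def
        proof (intro conjI ballI)
          fix x assume x: "x \<in> space X"
          have "space Y - Pair x -` (space (X \<Otimes>\<^sub>M Y) - S) = Pair x -` S"
            using x sets.sets_into_space[OF S] by (auto simp: space_pair_measure)
          moreover have "emeasure (l x) (Pair x -` S) = (\<integral>\<^sup>+y. g (x, y) * indicator (Pair x -` S) y \<partial>\<nu> x)"
            unfolding lg[OF x] using meas(2)[OF x] sec[OF S x] by (rule emeasure_density)
          moreover have "\<dots> = (\<integral>\<^sup>+y. 0 \<partial>\<nu> x)"
            by (intro nn_integral_cong) (auto simp: S_def split: split_indicator)
          ultimately show "emeasure (l x) (space Y - Pair x -` (space (X \<Otimes>\<^sub>M Y) - S)) = 0"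
            by simp
        qed auto
      qed auto
      show "kernel_infty_ac X (kernel_restrict k A) l"
        unfolding kernel_infty_ac_def
      proof (intro conjI ballI allI impI)
        show "kernel_ac X (kernel_restrict k A) l"
          using A by (rule ac) (auto simp: A_def S_def)
        fix x U assume x: "x \<in> space X" and U: "zero_infty_set (l x) U"
        interpret \<nu>x: finite_measure "\<nu> x"
          using finite_kernelD[OF \<nu> x] by simp
        have "U \<in> sets (\<nu> x)" and AE: "AE y in \<nu> x. y \<in> U \<longrightarrow> g (x, y) = 0 \<or> g (x, y) = \<infinity>"
          using U unfolding lg[OF x] \<nu>x.zero_infty_set_density_iff[OF meas(2)[OF x]] by auto
        \<comment> \<open>On \<open>A\<close> the value 0 of \<open>g\<close> is excluded, and
          \<open>g = \<infinity>\<close> forces \<open>f = \<infinity>\<close>; outside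
          \<open>A\<close> the product is 0.\<close>
        moreover have "AE y in \<nu> x. y \<in> U \<longrightarrow> f (x, y) * indicator A (x, y) = 0 \<or> f (x, y) * indicator A (x, y) = \<infinity>"
          using AE by eventually_elim (auto simp: A_def less_top[symmetric] split: split_indicator)
        ultimately show "zero_infty_set (kernel_restrict k A x) U"
          unfolding restr[OF A x] \<nu>x.zero_infty_set_density_iff[OF restr_meas[OF A x]] by simp
      qed
      show "infty_singular X Y (kernel_restrict k T) l"
        unfolding infty_singular_def
      proof (intro conjI ballI allI impI bexI[of _ T])
        show "kernel_ac X (kernel_restrict k T) l"
          using T by (rule ac) (auto simp: T_def S_def)
        show "supported_in X Y (kernel_restrict k T) T"
          by (rule supp[OF T])
        fix x assume x: "x \<in> space X"
        interpret \<nu>x: finite_measure "\<nu> x"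
          using finite_kernelD[OF \<nu> x] by simp
        show "zero_infty_set (l x) (Pair x -` T)"
          unfolding lg[OF x] \<nu>x.zero_infty_set_density_iff[OF meas(2)[OF x]]
          using sec[OF T x] by (auto simp: T_def)
        fix U assume "zero_infty_set (kernel_restrict k T x) U"
        then have U: "U \<in> sets (\<nu> x)"
          and AE: "AE y in \<nu> x. y \<in> U \<longrightarrow> f (x, y) * indicator T (x, y) = 0 \<or> f (x, y) * indicator T (x, y) = \<infinity>"
          unfolding restr[OF T x] \<nu>x.zero_infty_set_density_iff[OF restr_meas[OF T x]] by auto
        \<comment> \<open>\<open>f\<close> is finite on \<open>T\<close>, so the alternative
          \<infinity> cannot occur.\<close>
        have "AE y in \<nu> x. y \<in> U \<longrightarrow> f (x, y) * indicator T (x, y) = 0"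
          using AE by eventually_elim (auto simp: T_def split: split_indicator)
        then show "emeasure (kernel_restrict k T x) U = 0"
          using U unfolding restr[OF T x]
          by (intro null_setsD1) (simp add: null_sets_density_iff[OF restr_meas[OF T x]])
      qed (rule T)
      fix x B assume x: "x \<in> space X" and B: "B \<in> sets Y"
      have parts: "B \<inter> Pair x -` C \<in> sets (k x)" if "C \<in> sets (X \<Otimes>\<^sub>M Y)" for C
        using B that kernel_sets[OF kern_k x] by (auto simp: sets_Pair1)
      have disj: "Pair x -` A \<inter> Pair x -` T = {}" "(Pair x -` A \<union> Pair x -` T) \<inter> Pair x -` S = {}"
        by (auto simp: A_def T_def S_def)
      have "B = (B \<inter> Pair x -` A \<union> B \<inter> Pair x -` T) \<union> B \<inter> Pair x -` S"
        using x sets.sets_into_space[OF B] by (auto simp: A_def T_def S_def space_pair_measure)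
      then have "emeasure (k x) B = emeasure (k x) ((B \<inter> Pair x -` A \<union> B \<inter> Pair x -` T) \<union> B \<inter> Pair x -` S)"
        by simp
      also have "\<dots> = emeasure (k x) (B \<inter> Pair x -` A \<union> B \<inter> Pair x -` T) + emeasure (k x) (B \<inter> Pair x -` S)"
        using disj(2) by (intro plus_emeasure[symmetric] sets.Un parts A T S) blast
      also have "emeasure (k x) (B \<inter> Pair x -` A \<union> B \<inter> Pair x -` T)
          = emeasure (k x) (B \<inter> Pair x -` A) + emeasure (k x) (B \<inter> Pair x -` T)"
        using disj(1) by (intro plus_emeasure[symmetric] parts A T) blast
      finally show "emeasure (k x) B = emeasure (kernel_restrict k A x) B
          + emeasure (kernel_restrict k T x) B + emeasure (kernel_restrict k S x) B"
        by (simp add: emeasure_kernel_restrict[OF kern_k _ x B] A T S)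
    qed
  qed
qed

section \<open>Uniqueness\<close>

text \<open>Counterpart of \<open>mutually_singular\<close> at a fixed \<open>x\<close>, with
  \<open>D\<close> in the role of the section of a separating set.\<close>

definition singular_measures :: "'b measure \<Rightarrow> 'b measure \<Rightarrow> bool" where
  "singular_measures a b \<longleftrightarrow> (\<exists>D\<in>sets a. emeasure a (space a - D) = 0 \<and> emeasure b D = 0)"

lemma singular_measuresE:
  assumes "singular_measures a b" "sets a = sets n"
  obtains D where "D \<in> sets n" "emeasure a (space n - D) = 0" "emeasure b D = 0"
  using assms sets_eq_imp_space_eq[OF assms(2)] unfolding singular_measures_def by auto

text \<open>The content of \<open>lebesgue_decomposition\<close> at a fixed \<open>x\<close>:
  \<open>m\<close> and \<open>n\<close> stand for \<open>k x\<close> and \<open>l x\<close>, and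
  \<open>a\<close>, \<open>b\<close>, \<open>c\<close> for the absolutely continuous,
  \<infinity>-singular and singular parts. The separating sets may now depend on \<open>x\<close> in
  any way.\<close>

definition measure_decomposition ::
    "'b measure \<Rightarrow> 'b measure \<Rightarrow> 'b measure \<Rightarrow> 'b measure \<Rightarrow> 'b measure \<Rightarrow> bool" where
  "measure_decomposition m n a b c \<longleftrightarrow>
    sets a = sets n \<and> sets b = sets n \<and> sets c = sets n \<and>
    (\<forall>B\<in>sets n. emeasure m B = emeasure a B + emeasure b B + emeasure c B) \<and>
    singular_measures a b \<and> singular_measures a c \<and> singular_measures b c \<and> singular_measures c n \<and>
    absolutely_continuous n a \<and> absolutely_continuous n b \<and>
    (\<forall>U. zero_infty_set n U \<longrightarrow> zero_infty_set a U) \<and>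
    (\<forall>U. zero_infty_set b U \<longrightarrow> emeasure b U = 0) \<and>
    (\<exists>E. zero_infty_set n E \<and> emeasure b (space n - E) = 0)"

lemma emeasure_Int_conull:
  assumes "B \<in> sets m" "D \<in> sets m" "emeasure m (space m - D) = 0"
  shows "emeasure m (B \<inter> D) = emeasure m B"
proof -
  have "B \<inter> D = B - (space m - D)"
    using sets.sets_into_space[OF assms(1)] by auto
  then show ?thesis
    using assms by (simp add: emeasure_Diff_null_set null_setsI)
qed

lemma emeasure_subset_null: "emeasure m D = 0 \<Longrightarrow> D \<in> sets m \<Longrightarrow> B \<subseteq> D \<Longrightarrow> emeasure m B = 0"
  using emeasure_mono[of B D m] by simp

lemma absolutely_continuousD:
  "absolutely_continuous n a \<Longrightarrow> sets a = sets n \<Longrightarrow> D \<in> sets n \<Longrightarrow> emeasure n D = 0 \<Longrightarrow> emeasure a D = 0"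
  by (auto simp: absolutely_continuous_def null_sets_def)

lemma zero_infty_set_subset: "zero_infty_set m U \<Longrightarrow> V \<in> sets m \<Longrightarrow> V \<subseteq> U \<Longrightarrow> zero_infty_set m V"
  by (auto simp: zero_infty_set_def)

lemma zero_infty_set_cong:
  assumes "zero_infty_set a U" "sets b = sets a" "\<And>V. V \<in> sets a \<Longrightarrow> V \<subseteq> U \<Longrightarrow> emeasure b V = emeasure a V"
  shows "zero_infty_set b U"
  using assms by (auto simp: zero_infty_set_def)

text \<open>
  In the two lemmas below and in \<open>measure_decomposition_unique\<close> the measures may be infinite, so parts
  are compared on a common support instead of being subtracted.
\<close>

lemma singular_part_le:
  assumes D1: "measure_decomposition m n a b c" and D2: "measure_decomposition m n a' b' c'"
    and B: "B \<in> sets n"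
  shows "emeasure c B \<le> emeasure c' B"
proof -
  have sets: "sets a = sets n" "sets b = sets n" "sets c = sets n" "sets a' = sets n" "sets b' = sets n" "sets c' = sets n"
    using D1 D2 by (auto simp: measure_decomposition_def)
  have "singular_measures c n"
    using D1 by (simp add: measure_decomposition_def)
  then obtain N where N: "N \<in> sets n" "emeasure c (space n - N) = 0" "emeasure n N = 0"
    using sets(3) by (rule singular_measuresE)
  \<comment> \<open>\<open>N\<close> carries \<open>c\<close> and is \<open>n\<close>-null, so the
    absolutely continuous parts of both decompositions vanish on it; there \<open>m\<close>
    coincides with \<open>c\<close> as well as with \<open>c'\<close>.\<close>
  have "emeasure \<mu> (B \<inter> N) = 0" if "absolutely_continuous n \<mu>" "sets \<mu> = sets n" for \<mu>
    using emeasure_subset_null[of \<mu> N "B \<inter> N"] absolutely_continuousD[OF that N(1,3)] N(1) that(2) by simp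
  then have null: "emeasure a (B \<inter> N) = 0" "emeasure b (B \<inter> N) = 0" "emeasure a' (B \<inter> N) = 0" "emeasure b' (B \<inter> N) = 0"
    using D1 D2 by (simp_all add: measure_decomposition_def)
  have "emeasure c B = emeasure c (B \<inter> N)"
    using N B sets sets_eq_imp_space_eq[OF sets(3)] by (intro emeasure_Int_conull[symmetric]) auto
  also have "\<dots> = emeasure m (B \<inter> N)"
    using D1 null N B by (simp add: measure_decomposition_def)
  also have "\<dots> = emeasure c' (B \<inter> N)"
    using D2 null N B by (simp add: measure_decomposition_def)
  also have "\<dots> \<le> emeasure c' B"
    using B sets by (intro emeasure_mono) auto
  finally show ?thesis .
qed

lemma infty_singular_part_le:
  assumes D1: "measure_decomposition m n a b c" and D2: "measure_decomposition m n a' b' c'"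
    and B: "B \<in> sets n"
  shows "emeasure b B \<le> emeasure b' B"
proof -
  have sets: "sets a = sets n" "sets b = sets n" "sets c = sets n" "sets a' = sets n" "sets b' = sets n" "sets c' = sets n"
    using D1 D2 by (auto simp: measure_decomposition_def)
  note space = sets[THEN sets_eq_imp_space_eq]
  have m1: "emeasure m V = emeasure a V + emeasure b V + emeasure c V" if "V \<in> sets n" for V
    using D1 that by (simp add: measure_decomposition_def)
  have m2: "emeasure m V = emeasure a' V + emeasure b' V + emeasure c' V" if "V \<in> sets n" for V
    using D2 that by (simp add: measure_decomposition_def)
  have sing: "singular_measures a b" "singular_measures b c" "singular_measures a' b'" "singular_measures c' n"
    using D1 D2 by (simp_all add: measure_decomposition_def)
  have "\<exists>E. zero_infty_set n E \<and> emeasure b (space n - E) = 0"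
    using D1 by (simp add: measure_decomposition_def)
  then obtain E where E: "zero_infty_set n E" "emeasure b (space n - E) = 0" "E \<in> sets n"
    by (auto simp: zero_infty_set_def)
  obtain Da where Da: "Da \<in> sets n" "emeasure a (space n - Da) = 0" "emeasure b Da = 0"
    using sing(1) sets(1) by (rule singular_measuresE)
  obtain Db where Db: "Db \<in> sets n" "emeasure b (space n - Db) = 0" "emeasure c Db = 0"
    using sing(2) sets(2) by (rule singular_measuresE)
  obtain N where N: "N \<in> sets n" "emeasure c' (space n - N) = 0" "emeasure n N = 0"
    using sing(4) sets(6) by (rule singular_measuresE)
  obtain Da' where Da': "Da' \<in> sets n" "emeasure a' (space n - Da') = 0" "emeasure b' Da' = 0"
    using sing(3) sets(4) by (rule singular_measuresE)
  have bN: "emeasure b N = 0"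
    using D1 N sets by (auto simp: measure_decomposition_def intro: absolutely_continuousD)
  \<comment> \<open>\<open>G\<close> carries all of \<open>b\<close>, since \<open>E\<close> and
    \<open>Db\<close> are \<open>b\<close>-conull while \<open>Da\<close> and \<open>N\<close> are
    \<open>b\<close>-null. On \<open>G\<close> the measures \<open>a\<close>, \<open>c\<close> and
    \<open>c'\<close> vanish, so \<open>b = m = a' + b'\<close> there. Moreover \<open>G\<close>
    lies in the 0-\<infinity>-set \<open>E\<close> of \<open>n\<close>.\<close>
  define G where "G = ((E - Da) \<inter> Db) - N"
  have G: "G \<in> sets n" "G \<subseteq> E" "G \<subseteq> space n - Da" "G \<subseteq> Db" "G \<subseteq> space n - N"
    using E Da Db N sets.sets_into_space[OF E(3)] by (auto simp: G_def)
  have b_conull: "emeasure b (V \<inter> G) = emeasure b V" if V: "V \<in> sets n" for V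
  proof (rule emeasure_Int_conull)
    have sub: "space b - G \<subseteq> ((space n - E) \<union> Da) \<union> ((space n - Db) \<union> N)"
      using space(2) by (auto simp: G_def)
    have "((space n - E) \<union> Da) \<union> ((space n - Db) \<union> N) \<in> null_sets b"
      using E Da Db N bN sets by (intro null_sets.Un null_setsI) auto
    then show "emeasure b (space b - G) = 0"
      by (intro emeasure_subset_null[OF null_setsD1 null_setsD2 sub])
  qed (use V G sets in auto)
  have m_G: "emeasure b V = emeasure m V" "emeasure m V = emeasure a' V + emeasure b' V"
    if V: "V \<in> sets n" "V \<subseteq> G" for V
  proof -
    have "emeasure a V = 0"
      by (rule emeasure_subset_null[OF Da(2)]) (simp add: sets Da(1) sets.compl_sets, use V(2) G(3) in blast)
    moreover have "emeasure c V = 0"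
      by (rule emeasure_subset_null[OF Db(3)]) (simp add: sets Db(1), use V(2) G(4) in blast)
    moreover have "emeasure c' V = 0"
      by (rule emeasure_subset_null[OF N(2)]) (simp add: sets N(1) sets.compl_sets, use V(2) G(5) in blast)
    ultimately show "emeasure b V = emeasure m V" "emeasure m V = emeasure a' V + emeasure b' V"
      using m1[OF V(1)] m2[OF V(1)] by auto
  qed
  \<comment> \<open>On \<open>G \<inter> Da'\<close> also \<open>b'\<close> vanishes, so
    \<open>b\<close> agrees with \<open>a'\<close>, which takes only the values 0 and \<infinity>
    inside \<open>E\<close>. As the 0-\<infinity>-sets of \<open>b\<close> are trivial,
    \<open>b\<close> is zero on this set.\<close>
  have "zero_infty_set a' (G \<inter> Da')"
  proof (rule zero_infty_set_subset)
    show "zero_infty_set a' E"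
      using D2 E(1) by (simp add: measure_decomposition_def)
    show "G \<inter> Da' \<in> sets a'"
      using G(1) Da'(1) by (simp add: sets(4) sets.Int)
    show "G \<inter> Da' \<subseteq> E"
      using G(2) by blast
  qed
  then have "zero_infty_set b (G \<inter> Da')"
  proof (rule zero_infty_set_cong)
    fix V assume V: "V \<in> sets a'" "V \<subseteq> G \<inter> Da'"
    then have "emeasure b' V = 0"
      by (intro emeasure_subset_null[OF Da'(3)]) (simp_all add: sets Da'(1))
    then show "emeasure b V = emeasure a' V"
      using m_G[of V] V sets by auto
  qed (use sets in auto)
  then have zero: "emeasure b (G \<inter> Da') = 0"
    using D1 by (simp add: measure_decomposition_def)
  \<comment> \<open>Removing the \<open>b\<close>-null set \<open>G \<inter> Da'\<close> leaves a
    set on which \<open>a'\<close> vanishes, hence \<open>b = b'\<close> there.\<close>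
  let ?V = "(B \<inter> G) - (G \<inter> Da')"
  have V: "?V \<in> sets n" "?V \<subseteq> G"
    using B G Da' by auto
  have "emeasure b B = emeasure b (B \<inter> G)"
    using b_conull[OF B] by simp
  also have "\<dots> = emeasure b ?V"
    using zero B G Da' sets by (intro emeasure_Diff_null_set[symmetric] null_setsI) auto
  also have "\<dots> = emeasure a' ?V + emeasure b' ?V"
    using m_G[OF V] by simp
  also have "emeasure a' ?V = 0"
    by (rule emeasure_subset_null[OF Da'(2)])
      (simp add: sets Da'(1) sets.compl_sets, use sets.sets_into_space[OF V(1)] in blast)
  also have "0 + emeasure b' ?V \<le> emeasure b' B"
    using B sets by (auto intro!: emeasure_mono)
  finally show ?thesis .
qed

lemma measure_decomposition_unique:
  assumes D1: "measure_decomposition m n a b c" and D2: "measure_decomposition m n a' b' c'"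
  shows "a = a'" "b = b'" "c = c'"
proof -
  have sets: "sets a = sets n" "sets b = sets n" "sets c = sets n" "sets a' = sets n" "sets b' = sets n" "sets c' = sets n"
    using D1 D2 by (auto simp: measure_decomposition_def)
  show c: "c = c'"
    using sets singular_part_le[OF D1 D2] singular_part_le[OF D2 D1]
    by (intro measure_eqI antisym) auto
  show b: "b = b'"
    using sets infty_singular_part_le[OF D1 D2] infty_singular_part_le[OF D2 D1]
    by (intro measure_eqI antisym) auto
  \<comment> \<open>With \<open>b\<close> and \<open>c\<close> identified, both decompositions are
    compared on \<open>P \<inter> Q\<close>, which carries \<open>a\<close> and is null for
    \<open>b\<close> and \<open>c\<close>. The claim is stated for arbitrary \<open>a\<close> and
    \<open>a'\<close> so as to be used in both directions.\<close>
  have le: "emeasure a B \<le> emeasure a' B"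
    if D1: "measure_decomposition m n a b c" and D2: "measure_decomposition m n a' b c" and B: "B \<in> sets n" for a a' B
  proof -
    have sets: "sets a = sets n" "sets b = sets n" "sets c = sets n" "sets a' = sets n"
      using D1 D2 by (auto simp: measure_decomposition_def)
    have sing: "singular_measures a b" "singular_measures a c"
      using D1 by (simp_all add: measure_decomposition_def)
    note space = sets_eq_imp_space_eq[OF sets(1)]
    obtain P where P: "P \<in> sets n" "emeasure a (space n - P) = 0" "emeasure b P = 0"
      using sing(1) sets(1) by (rule singular_measuresE)
    obtain Q where Q: "Q \<in> sets n" "emeasure a (space n - Q) = 0" "emeasure c Q = 0"
      using sing(2) sets(1) by (rule singular_measuresE)
    have zero: "emeasure b (B \<inter> P \<inter> Q) = 0" "emeasure c (B \<inter> P \<inter> Q) = 0"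
      using P Q sets by (auto intro: emeasure_subset_null[of b P] emeasure_subset_null[of c Q])
    have "emeasure a B = emeasure a (B \<inter> P \<inter> Q)"
      using P Q B sets space emeasure_Int_conull[of B a P] emeasure_Int_conull[of "B \<inter> P" a Q] by simp
    also have "\<dots> = emeasure m (B \<inter> P \<inter> Q)"
      using D1 zero B P Q by (simp add: measure_decomposition_def)
    also have "\<dots> = emeasure a' (B \<inter> P \<inter> Q)"
      using D2 zero B P Q by (simp add: measure_decomposition_def)
    also have "\<dots> \<le> emeasure a' B"
      using B sets by (intro emeasure_mono) auto
    finally show ?thesis .
  qed
  show "a = a'"
    using sets le[of a a'] le[of a' a] D1 D2 b c
    by (intro measure_eqI antisym) auto
qed

section \<open>Passage from kernels to their values and back\<close>

lemma mutually_singular_section: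
  assumes "mutually_singular X Y k l" "kernel X Y k" "kernel X Y l" and x: "x \<in> space X"
  shows "singular_measures (k x) (l x)"
proof -
  obtain A where A: "A \<in> sets (X \<Otimes>\<^sub>M Y)" "supported_in X Y k A" "supported_in X Y l (space (X \<Otimes>\<^sub>M Y) - A)"
    using assms(1) unfolding mutually_singular_def by blast
  have "space Y - Pair x -` (space (X \<Otimes>\<^sub>M Y) - A) = Pair x -` A"
    using x sets.sets_into_space[OF A(1)] by (auto simp: space_pair_measure)
  then show ?thesis
    unfolding singular_measures_def using A x kernel_sets[OF assms(2) x] kernel_space[OF assms(2) x]
    by (intro bexI[of _ "Pair x -` A"]) (auto simp: supported_in_def sets_Pair1)
qed

lemma lebesgue_decomposition_section:
  assumes D: "lebesgue_decomposition X Y k l ka kinf ks" and l: "kernel X Y l" and x: "x \<in> space X"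
  shows "measure_decomposition (k x) (l x) (ka x) (kinf x) (ks x)"
proof -
  have kern: "kernel X Y ka" "kernel X Y kinf" "kernel X Y ks"
    using D by (auto simp: lebesgue_decomposition_def)
  obtain A where A: "supported_in X Y kinf A" "zero_infty_set (l x) (Pair x -` A)"
    using D x unfolding lebesgue_decomposition_def infty_singular_def by blast
  then have E: "\<exists>E. zero_infty_set (l x) E \<and> emeasure (kinf x) (space (l x) - E) = 0"
    using x kernel_space[OF l x] by (auto simp: supported_in_def)
  have "singular_measures (ka x) (kinf x)" "singular_measures (ka x) (ks x)"
    "singular_measures (kinf x) (ks x)" "singular_measures (ks x) (l x)"
    using D kern l x by (auto simp: lebesgue_decomposition_def intro: mutually_singular_section)
  moreover have "absolutely_continuous (l x) (ka x)" "absolutely_continuous (l x) (kinf x)"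
    "\<forall>U. zero_infty_set (l x) U \<longrightarrow> zero_infty_set (ka x) U"
    "\<forall>U. zero_infty_set (kinf x) U \<longrightarrow> emeasure (kinf x) U = 0"
    using D x by (auto simp: lebesgue_decomposition_def kernel_infty_ac_def infty_singular_def kernel_ac_def)
  moreover have "\<forall>B\<in>sets (l x). emeasure (k x) B = emeasure (ka x) B + emeasure (kinf x) B + emeasure (ks x) B"
    using D x kernel_sets[OF l x] by (simp add: lebesgue_decomposition_def)
  ultimately show ?thesis
    unfolding measure_decomposition_def using E kern[THEN kernel_sets, OF x] kernel_sets[OF l x]
    by (intro conjI) simp_all
qed

text \<open>Uniqueness identifies kernels on \<open>space X\<close> only; this lemma and the next
  two let finiteness properties pass between kernels that agree there.\<close>

lemma kernel_cong:
  assumes "\<And>x. x \<in> space X \<Longrightarrow> k x = k' x"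
  shows "kernel X Y k \<longleftrightarrow> kernel X Y k'"
  using assms by (simp add: kernel_def cong: measurable_cong)

lemma s_finite_kernel_cong:
  assumes "\<And>x. x \<in> space X \<Longrightarrow> k x = k' x"
  shows "s_finite_kernel X Y k \<longleftrightarrow> s_finite_kernel X Y k'"
  using assms kernel_cong[of X k k' Y] by (simp add: s_finite_kernel_def kernel_suminf_def)

lemma sigma_finite_kernel_cong:
  assumes "\<And>x. x \<in> space X \<Longrightarrow> k x = k' x"
  shows "sigma_finite_kernel X Y k \<longleftrightarrow> sigma_finite_kernel X Y k'"
  using assms kernel_cong[of X k k' Y] by (simp add: sigma_finite_kernel_def kernel_suminf_def)

theorem theorem11:
  fixes X :: "'a measure" and Y :: "'b measure" and k l :: "'a \<Rightarrow> 'b measure"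
  assumes "countable_discrete X \<or> standard_borel Y"
    and "s_finite_kernel X Y k"
    and "s_finite_kernel X Y l"
  shows "(\<exists>ka kinf ks. lebesgue_decomposition X Y k l ka kinf ks)
    \<and> (\<forall>ka kinf ks ka' kinf' ks'.
          lebesgue_decomposition X Y k l ka kinf ks \<longrightarrow>
          lebesgue_decomposition X Y k l ka' kinf' ks' \<longrightarrow>
          (\<forall>x\<in>space X. ka x = ka' x \<and> kinf x = kinf' x \<and> ks x = ks' x))
    \<and> (\<forall>ka kinf ks. lebesgue_decomposition X Y k l ka kinf ks \<longrightarrow>
          s_finite_kernel X Y ka \<and> sigma_finite_kernel X Y kinf \<and> s_finite_kernel X Y ks)"
proof -
  obtain ka kinf ks where D: "lebesgue_decomposition X Y k l ka kinf ks"
    and fin: "s_finite_kernel X Y ka" "sigma_finite_kernel X Y kinf" "s_finite_kernel X Y ks"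
    by (rule exists_lebesgue_decomposition[OF assms])
  have l: "kernel X Y l"
    using assms(3) by (simp add: s_finite_kernel_def)
  have unique: "ka x = ka' x \<and> kinf x = kinf' x \<and> ks x = ks' x"
    if "lebesgue_decomposition X Y k l ka kinf ks" "lebesgue_decomposition X Y k l ka' kinf' ks'" "x \<in> space X"
    for ka kinf ks ka' kinf' ks' x
    using measure_decomposition_unique[OF that(1,2)[THEN lebesgue_decomposition_section, OF l that(3)]] by blast
  \<comment> \<open>Finiteness is known for the constructed decomposition; by uniqueness any other
    one agrees with it on \<open>space X\<close>.\<close>
  have "s_finite_kernel X Y ka' \<and> sigma_finite_kernel X Y kinf' \<and> s_finite_kernel X Y ks'"
    if "lebesgue_decomposition X Y k l ka' kinf' ks'" for ka' kinf' ks'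
    using unique[OF D that] fin s_finite_kernel_cong[of X ka ka' Y] s_finite_kernel_cong[of X ks ks' Y]
      sigma_finite_kernel_cong[of X kinf kinf' Y] by blast
  with D unique show ?thesis
    by blast
qed

end
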